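(* Assume that $\{x:F(x)\preceq_C F(x^0)\}$ is bounded, that $F$ is $(L,C,e)$-smooth relative to $\omega$ for some $L>0$, that $\ell>\frac{L}{1+\alpha(\omega)}$, and that $F$ is $C$-convex on $\Omega$. Let $\{x^k\}$ be the infinite sequence of nonstationary points generated by $x^{k+1}=V_\ell(x^k)$ from $x^0\in\mathrm{int}(\Omega)$. Then: (i) there exists $F^*\in\mathbb{R}^m$ with $F^*\preceq_C F(x^k)$ for all $k$ and $\lim_{k\to\infty}F(x^k)=F^*$; (ii) $\sum_{k=0}^{\infty}D_\omega(x^{k+1},x^k)<\infty$; (iii) every accumulation point of $\{x^k\}$ is a weakly efficient solution of $\min_{x\in\Omega}F(x)$; and if the Bregman convergence assumption on $\omega$ (stated in the context) holds, then $\{x^k\}$ converges to some weakly efficient solution $x^*$; (iv) under the Bregman convergence assumption, with $x^*$ the limit in (iii), for all $k\ge1$, $$\langle\bar c_\ell^{\,k-1},F(x^k)-F^*\rangle\le\frac{\ell D_\omega(x^*,x^0)+(L-\ell)\sum_{p=0}^{k-1}D_\omega(x^{p+1},x^p)}{k},\qquad \bar c_\ell^{\,k-1}=\frac1k\sum_{p=0}^{k-1}c_\ell(x^p);$$ (v) under the Bregman convergence assumption, with $x^*$ the limit in (iii), if $\ell\ge L$, then for all $k\ge1$, $\langle\bar c_\ell^{\,k-1},F(x^k)-F^*\rangle\le\frac{\ell D_\omega(x^*,x^0)}{k}$, with the same $\bar c_\ell^{\,k-1}$.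
   Context: $C\subset\mathbb{R}^m$ is a closed, convex, pointed cone with nonempty interior; $y\preceq_C y'$ (resp. $y\prec_C y'$) means $y'-y\in C$ (resp. $\mathrm{int}(C)$). $C^*=\{c^*\in\mathbb{R}^m:\langle c^*,c\rangle\ge 0\ \forall c\in C\}$ and $G=\mathrm{conv}(\{c^*\in C^*:\|c^*\|=1\})$. $\Omega\subset\mathbb{R}^n$ is closed and convex with nonempty interior, $F:\mathbb{R}^n\to\mathbb{R}^m$ is differentiable with Jacobian $JF(x)\in\mathbb{R}^{m\times n}$. $F$ is $C$-convex on $\Omega$ if $F(\lambda x+(1-\lambda)y)\preceq_C\lambda F(x)+(1-\lambda)F(y)$ for all $x,y\in\Omega$, $\lambda\in[0,1]$. A point $x^*\in\Omega$ is $C$-stationary if $JF(x^* )(\Omega-x^* )\cap(-\mathrm{int}(C))=\emptyset$, and is a weakly efficient solution if there is no $x\in\Omega$ with $F(x)\prec_C F(x^* )$. Legendre function: a proper closed convex function $\omega$ on $\mathbb{R}^n$ with values in $(-\infty,+\infty]$ that is essentially smooth (differentiable on $\mathrm{int}(\mathrm{dom}\,\omega)$, with $\|\nabla\omega(x^k)\|\to\infty$ for every sequence $\{x^k\}\subset\mathrm{int}(\mathrm{dom}\,\omega)$ converging to a boundary point of $\mathrm{dom}\,\omega$) and strictly convex on $\mathrm{int}(\mathrm{dom}\,\omega)$. Here $\omega$ is a Legendre function with $\mathrm{cl}(\mathrm{dom}\,\omega)=\Omega$, and it is supercoercive: $\lim_{\|x\|\to\infty}\omega(x)/\|x\|=\infty$.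 Bregman distance: $D_\omega(x,y)=\omega(x)-\omega(y)-\langle\nabla\omega(y),x-y\rangle$ for $y\in\mathrm{int}(\mathrm{dom}\,\omega)$ (equal to $+\infty$ when $\omega(x)=+\infty$). Symmetry coefficient: $\alpha(\omega)=\inf\{D_\omega(x,y)/D_\omega(y,x):x,y\in\mathrm{int}(\mathrm{dom}\,\omega),\ x\ne y\}\in[0,1]$. Bregman convergence assumption: (a) if $\{z^k\}\subset\mathrm{int}(\Omega)$ converges to some $z\in\Omega$, then $D_\omega(z,z^k)\to0$; (b) if $z\in\Omega$ and $\{z^k\}\subset\mathrm{int}(\Omega)$ satisfies $D_\omega(z,z^k)\to0$, then $z^k\to z$. The vector $e$: $e=\arg\max_{c\in B[0,r]}\min_{c^*\in G}\langle c^*,c\rangle$, where $B[0,r]$ is the closed ball of radius $r$ centred at $0$ and $r>0$ is selected so that $\max_{c^*\in G}\langle c^*,e\rangle=1$; then $e\in\mathrm{int}(C)$. Relative smoothness: $F$ is $(L,C,e)$-smooth relative to $\omega$ (on $\Omega\subseteq\mathrm{dom}(\omega)$), with $L>0$, if $F(y)\preceq_C F(x)+JF(x)(y-x)+LD_\omega(y,x)e$ for all $x,y\in\mathrm{int}(\Omega)$. For $\ell>0$ and $x\in\mathrm{int}(\Omega)$: $V_\ell(x)$ is the unique maximizer over $y\in\Omega$ of $\min_{c^*\in G}\{\langle c^*,JF(x)(x-y)\rangle-\ell D_\omega(y,x)\}$; it lies in $\mathrm{int}(\Omega)$ (well defined since $\omega$ is supercoercive). $c_\ell(x)\in G$ denotes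 a vector such that $V_\ell(x)=\arg\sup_{y\in\Omega}\{\langle c_\ell(x),JF(x)(x-y)\rangle-\ell D_\omega(y,x)\}$ and $c_\ell(x)\in\arg\min_{c^*\in G}\langle c^*,JF(x)(x-V_\ell(x))\rangle$ (such a vector exists). The interior Bregman gradient method starts at $x^0\in\mathrm{int}(\Omega)$ and iterates $x^{k+1}=V_\ell(x^k)$, stopping if $x^{k+1}=x^k$; it is assumed throughout that it generates an infinite sequence of points that are not $C$-stationary. *)

theory Defs
  imports "HOL-Analysis.Analysis"
begin

section \<open>Cones and the induced orders\<close>

definition cone_le :: "'a::real_normed_vector \<Rightarrow> 'a set \<Rightarrow> 'a \<Rightarrow> bool"
    ("(_ \<preceq>\<^bsub>_\<^esub> _)" [51, 0, 51] 50) where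
  "y \<preceq>\<^bsub>C\<^esub> y' \<longleftrightarrow> y' - y \<in> C"

definition cone_less :: "'a::real_normed_vector \<Rightarrow> 'a set \<Rightarrow> 'a \<Rightarrow> bool"
    ("(_ \<prec>\<^bsub>_\<^esub> _)" [51, 0, 51] 50) where
  "y \<prec>\<^bsub>C\<^esub> y' \<longleftrightarrow> y' - y \<in> interior C"

definition ordering_cone :: "'a::real_normed_vector set \<Rightarrow> bool" where
  "ordering_cone C \<longleftrightarrow>
     closed C \<and> convex C \<and> cone C \<and> C \<inter> uminus ` C = {0} \<and> interior C \<noteq> {}"

definition dual_cone :: "'a::real_inner set \<Rightarrow> 'a set" where
  "dual_cone C = {c'. \<forall>c\<in>C. 0 \<le> c' \<bullet> c}"

definition dual_base :: "'a::real_inner set \<Rightarrow> 'a set" where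
  "dual_base C = convex hull {c' \<in> dual_cone C. norm c' = 1}"

text \<open>For an ordering cone in a nontrivial Euclidean space, \<^term>\<open>dual_base C\<close> is nonempty and
  compact, so the infima and suprema over it below are attained.\<close>

definition scaling_vector :: "'a::real_inner set \<Rightarrow> real \<Rightarrow> 'a \<Rightarrow> bool" where
  "scaling_vector C r e \<longleftrightarrow>
     0 < r \<and>
     is_arg_max (\<lambda>c. INF c'\<in>dual_base C. c' \<bullet> c) (\<lambda>c. c \<in> cball 0 r) e \<and>
     (SUP c'\<in>dual_base C. c' \<bullet> e) = 1"


section \<open>Vector optimization over a constraint set\<close>

definition C_convex_on ::
    "'b::real_normed_vector set \<Rightarrow> 'a::real_vector set \<Rightarrow> ('a \<Rightarrow> 'b) \<Rightarrow> bool" where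
  "C_convex_on C \<Omega> F \<longleftrightarrow>
     (\<forall>x\<in>\<Omega>. \<forall>y\<in>\<Omega>. \<forall>t\<in>{0..1}.
        F (t *\<^sub>R x + (1 - t) *\<^sub>R y) \<preceq>\<^bsub>C\<^esub> t *\<^sub>R F x + (1 - t) *\<^sub>R F y)"

abbreviation jac :: "(real^'n \<Rightarrow> real^'m) \<Rightarrow> real^'n \<Rightarrow> real^'n^'m" where
  "jac F x \<equiv> jacobian F (at x)"

definition C_stationary ::
    "(real^'m) set \<Rightarrow> (real^'n) set \<Rightarrow> (real^'n \<Rightarrow> real^'m) \<Rightarrow> real^'n \<Rightarrow> bool" where
  "C_stationary C \<Omega> F x \<longleftrightarrow>
     x \<in> \<Omega> \<and> (\<lambda>y. jac F x *v (y - x)) ` \<Omega> \<inter> uminus ` interior C = {}"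

definition weakly_efficient ::
    "'b::real_normed_vector set \<Rightarrow> 'a set \<Rightarrow> ('a \<Rightarrow> 'b) \<Rightarrow> 'a \<Rightarrow> bool" where
  "weakly_efficient C \<Omega> F x \<longleftrightarrow> x \<in> \<Omega> \<and> \<not> (\<exists>y\<in>\<Omega>. F y \<prec>\<^bsub>C\<^esub> F x)"


section \<open>Legendre functions and Bregman distances\<close>

definition edom :: "('a \<Rightarrow> ereal) \<Rightarrow> 'a set" where
  "edom \<omega> = {x. \<omega> x < \<infinity>}"

definition grad :: "('a::real_inner \<Rightarrow> ereal) \<Rightarrow> 'a \<Rightarrow> 'a" where
  "grad \<omega> x = (THE D. GDERIV (\<lambda>z. real_of_ereal (\<omega> z)) x :> D)"

definition proper_closed_convex :: "('a::real_normed_vector \<Rightarrow> ereal) \<Rightarrow> bool" where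
  "proper_closed_convex \<omega> \<longleftrightarrow>
     (\<forall>x. \<omega> x \<noteq> -\<infinity>) \<and> edom \<omega> \<noteq> {} \<and>
     closed {(x, s::real). \<omega> x \<le> ereal s} \<and> convex {(x, s::real). \<omega> x \<le> ereal s}"

definition essentially_smooth :: "('a::real_inner \<Rightarrow> ereal) \<Rightarrow> bool" where
  "essentially_smooth \<omega> \<longleftrightarrow>
     (\<forall>x\<in>interior (edom \<omega>). (\<lambda>z. real_of_ereal (\<omega> z)) differentiable (at x)) \<and>
     (\<forall>z b. (\<forall>k::nat. z k \<in> interior (edom \<omega>)) \<longrightarrow> b \<in> frontier (edom \<omega>) \<longrightarrow> z \<longlonglongrightarrow> b \<longrightarrow>
        filterlim (\<lambda>k. norm (grad \<omega> (z k))) at_top sequentially)"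

definition strictly_convex_interior :: "('a::real_normed_vector \<Rightarrow> ereal) \<Rightarrow> bool" where
  "strictly_convex_interior \<omega> \<longleftrightarrow>
     (\<forall>x\<in>interior (edom \<omega>). \<forall>y\<in>interior (edom \<omega>). \<forall>t\<in>{0<..<1}. x \<noteq> y \<longrightarrow>
        \<omega> (t *\<^sub>R x + (1 - t) *\<^sub>R y) < ereal t * \<omega> x + ereal (1 - t) * \<omega> y)"

definition legendre :: "('a::real_inner \<Rightarrow> ereal) \<Rightarrow> bool" where
  "legendre \<omega> \<longleftrightarrow>
     proper_closed_convex \<omega> \<and> essentially_smooth \<omega> \<and> strictly_convex_interior \<omega>"

definition supercoercive :: "('a::real_normed_vector \<Rightarrow> ereal) \<Rightarrow> bool" where
  "supercoercive \<omega> \<longleftrightarrow> ((\<lambda>x. \<omega> x / ereal (norm x)) \<longlongrightarrow> \<infinity>) at_infinity"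

text \<open>Only meaningful for \<open>y\<close> in the interior of the domain, where \<open>\<omega> y\<close> is finite;
  it is then \<open>\<infinity>\<close> exactly when \<open>\<omega> x = \<infinity>\<close>.\<close>

definition bregman :: "('a::real_inner \<Rightarrow> ereal) \<Rightarrow> 'a \<Rightarrow> 'a \<Rightarrow> ereal" where
  "bregman \<omega> x y = \<omega> x - \<omega> y - ereal (grad \<omega> y \<bullet> (x - y))"

definition symmetry_coeff :: "('a::real_inner \<Rightarrow> ereal) \<Rightarrow> real" where
  "symmetry_coeff \<omega> =
     Inf {real_of_ereal (bregman \<omega> x y) / real_of_ereal (bregman \<omega> y x) | x y.
            x \<in> interior (edom \<omega>) \<and> y \<in> interior (edom \<omega>) \<and> x \<noteq> y}"

definition bregman_convergence :: "('a::real_inner \<Rightarrow> ereal) \<Rightarrow> 'a set \<Rightarrow> bool" where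
  "bregman_convergence \<omega> \<Omega> \<longleftrightarrow>
     (\<forall>z\<in>\<Omega>. \<forall>y. (\<forall>k::nat. y k \<in> interior \<Omega>) \<longrightarrow> y \<longlonglongrightarrow> z \<longrightarrow> (\<lambda>k. bregman \<omega> z (y k)) \<longlonglongrightarrow> 0) \<and>
     (\<forall>z\<in>\<Omega>. \<forall>y. (\<forall>k::nat. y k \<in> interior \<Omega>) \<longrightarrow> (\<lambda>k. bregman \<omega> z (y k)) \<longlonglongrightarrow> 0 \<longrightarrow> y \<longlonglongrightarrow> z)"

definition relatively_smooth ::
    "(real^'m) set \<Rightarrow> real^'m \<Rightarrow> (real^'n) set \<Rightarrow> (real^'n \<Rightarrow> ereal) \<Rightarrow> real
      \<Rightarrow> (real^'n \<Rightarrow> real^'m) \<Rightarrow> bool" where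
  "relatively_smooth C e \<Omega> \<omega> L F \<longleftrightarrow>
     0 < L \<and> \<Omega> \<subseteq> edom \<omega> \<and>
     (\<forall>x\<in>interior \<Omega>. \<forall>y\<in>interior \<Omega>.
        F y \<preceq>\<^bsub>C\<^esub> F x + jac F x *v (y - x) + (L * real_of_ereal (bregman \<omega> y x)) *\<^sub>R e)"


section \<open>The interior Bregman gradient method\<close>

definition bregman_step ::
    "(real^'m) set \<Rightarrow> (real^'n) set \<Rightarrow> (real^'n \<Rightarrow> ereal) \<Rightarrow> (real^'n \<Rightarrow> real^'m) \<Rightarrow> real
      \<Rightarrow> real^'n \<Rightarrow> real^'n" where
  "bregman_step C \<Omega> \<omega> F l x =
     (THE v. is_arg_max
        (\<lambda>y. INF c\<in>dual_base C. ereal (c \<bullet> (jac F x *v (x - y))) - ereal l * bregman \<omega> y x)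
        (\<lambda>y. y \<in> \<Omega>) v)"

definition step_multiplier ::
    "(real^'m) set \<Rightarrow> (real^'n) set \<Rightarrow> (real^'n \<Rightarrow> ereal) \<Rightarrow> (real^'n \<Rightarrow> real^'m) \<Rightarrow> real
      \<Rightarrow> real^'n \<Rightarrow> real^'m \<Rightarrow> bool" where
  "step_multiplier C \<Omega> \<omega> F l x c \<longleftrightarrow>
     c \<in> dual_base C \<and>
     is_arg_max (\<lambda>y. ereal (c \<bullet> (jac F x *v (x - y))) - ereal l * bregman \<omega> y x)
        (\<lambda>y. y \<in> \<Omega>) (bregman_step C \<Omega> \<omega> F l x) \<and>
     is_arg_min (\<lambda>c'. c' \<bullet> (jac F x *v (x - bregman_step C \<Omega> \<omega> F l x)))
        (\<lambda>c'. c' \<in> dual_base C) c"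

text \<open>An infinite run: the stopping test \<open>x (Suc k) = x k\<close> never succeeds.\<close>

definition interior_bregman_run ::
    "(real^'m) set \<Rightarrow> (real^'n) set \<Rightarrow> (real^'n \<Rightarrow> ereal) \<Rightarrow> (real^'n \<Rightarrow> real^'m) \<Rightarrow> real
      \<Rightarrow> (nat \<Rightarrow> real^'n) \<Rightarrow> bool" where
  "interior_bregman_run C \<Omega> \<omega> F l x \<longleftrightarrow>
     x 0 \<in> interior \<Omega> \<and>
     (\<forall>k. x (Suc k) = bregman_step C \<Omega> \<omega> F l (x k) \<and> x (Suc k) \<noteq> x k)"

end

theory Submission
  imports Defs
begin

text \<open>Each step minimises \<open>h y + l * D y x\<close>, where \<open>h y\<close> is the supremum of \<open>c \<bullet> JF(x)(y - x)\<close> over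
  \<open>c \<in> dual_base C\<close>. Essential smoothness keeps the minimiser \<open>v\<close> in the interior, and there convexity
  of \<open>h\<close> gives the three-point inequality \<open>h v + l * D v x + l * D y v \<le> h y + l * D y x\<close> for all \<open>y\<close>.
  With \<open>y = x\<close> and relative smoothness, \<open>F\<close> decreases by a multiple of \<open>D v x\<close>, which yields the
  limit value and summability. With general \<open>y\<close> and \<open>C\<close>-convexity, a uniform lower bound on
  \<open>c \<bullet> (F v - F y)\<close> over the dual base bounds the change of \<open>D y\<close>; summation over the run shows weak
  efficiency and makes the run quasi-Fejer monotone with respect to accumulation points. Only values
  of the supremum enter, so no minimax theorem is needed. The same inequality for the linear model
  of a given multiplier telescopes to the rate.\<close>

section \<open>Bregman proximal points of Legendre functions\<close>

definition bregman_real :: "('a::real_inner \<Rightarrow> real) \<Rightarrow> ('a \<Rightarrow> 'a) \<Rightarrow> 'a \<Rightarrow> 'a \<Rightarrow> real" where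
  "bregman_real w g y z = w y - w z - g z \<bullet> (y - z)"

lemma bregman_real_three_point:
  "bregman_real w g y x - bregman_real w g v x - bregman_real w g y v = (g v - g x) \<bullet> (y - v)"
  by (simp add: bregman_real_def algebra_simps)

text \<open>A real-valued rendering of a supercoercive Legendre function with closed domain
  \<open>W\<close>, free of extended arithmetic. \<open>closed_epigraph\<close> expresses lower
  semicontinuity up to the boundary, \<open>gderiv\<close> with \<open>blowup\<close> essential
  smoothness.\<close>

locale legendre_real =
  fixes W :: "'a::euclidean_space set" and w :: "'a \<Rightarrow> real" and g :: "'a \<Rightarrow> 'a"
  assumes closed_W: "closed W"
    and interior_W: "interior W \<noteq> {}"
    and convex_w: "convex_on W w"
    and closed_epigraph: "closed {(y, s). y \<in> W \<and> w y \<le> s}"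
    and gderiv: "z \<in> interior W \<Longrightarrow> GDERIV w z :> g z"
    and blowup: "\<lbrakk>\<And>k::nat. u k \<in> interior W; b \<in> frontier W; u \<longlonglongrightarrow> b\<rbrakk>
      \<Longrightarrow> filterlim (\<lambda>k. norm (g (u k))) at_top sequentially"
    and strict: "\<lbrakk>y \<in> interior W; z \<in> interior W; y \<noteq> z; 0 < t; t < 1\<rbrakk>
      \<Longrightarrow> w (t *\<^sub>R y + (1 - t) *\<^sub>R z) < t * w y + (1 - t) * w z"
    and coercive: "\<exists>B. \<forall>y\<in>W. B \<le> norm y \<longrightarrow> M * norm y \<le> w y"
begin

abbreviation D where "D \<equiv> bregman_real w g"

lemma convex_W: "convex W"
  using convex_w by (rule convex_on_imp_convex)

lemma interior_subset_W: "z \<in> interior W \<Longrightarrow> z \<in> W"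
  using interior_subset by blast

lemma directional_derivative:
  assumes "z \<in> interior W"
  shows "((\<lambda>t. (w (z + t *\<^sub>R d) - w z) / t) \<longlongrightarrow> g z \<bullet> d) (at_right 0)"
proof -
  have "(w has_derivative (\<lambda>h. h \<bullet> g z)) (at (z + 0 *\<^sub>R d))"
    using gderiv[OF assms] by (simp add: gderiv_def)
  moreover have "((\<lambda>t. z + t *\<^sub>R d) has_derivative (\<lambda>t. t *\<^sub>R d)) (at 0)"
    by (auto intro!: derivative_eq_intros)
  ultimately have "((\<lambda>t. w (z + t *\<^sub>R d)) has_derivative (\<lambda>t. (t *\<^sub>R d) \<bullet> g z)) (at (0::real))"
    by (rule has_derivative_compose[rotated])
  then have "((\<lambda>t. w (z + t *\<^sub>R d)) has_real_derivative (g z \<bullet> d)) (at 0)"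
    by (simp add: has_field_derivative_def inner_commute mult_commute_abs)
  then have "((\<lambda>t. (w (z + t *\<^sub>R d) - w z) / t) \<longlongrightarrow> g z \<bullet> d) (at 0)"
    by (simp add: DERIV_def)
  then show ?thesis
    by (rule tendsto_within_subset) auto
qed

lemma convex_segment:
  assumes "v \<in> W" "y \<in> W" "0 \<le> t" "t \<le> 1"
  shows "w (v + t *\<^sub>R (y - v)) \<le> w v + t * (w y - w v)" "v + t *\<^sub>R (y - v) \<in> W"
proof -
  have eq: "v + t *\<^sub>R (y - v) = (1 - t) *\<^sub>R v + t *\<^sub>R y"
    by (simp add: algebra_simps)
  have "w ((1 - t) *\<^sub>R v + t *\<^sub>R y) \<le> (1 - t) * w v + t * w y"
    using convex_onD[OF convex_w] assms by blast
  then show "w (v + t *\<^sub>R (y - v)) \<le> w v + t * (w y - w v)"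
    unfolding eq by (simp add: algebra_simps)
  show "v + t *\<^sub>R (y - v) \<in> W"
    unfolding eq using convex_W assms by (simp add: convexD)
qed

text \<open>Convexity bounds the difference quotients from \<open>z\<close> towards \<open>y\<close>
  by \<open>w y - w z\<close>, and they tend to the directional derivative. The point
  \<open>y\<close> may lie on the boundary.\<close>

lemma bregman_real_nonneg:
  assumes "z \<in> interior W" "y \<in> W"
  shows "0 \<le> D y z"
proof -
  have "eventually (\<lambda>t. (w (z + t *\<^sub>R (y - z)) - w z) / t \<le> w y - w z) (at_right (0::real))"
    unfolding eventually_at_right_field
  proof (intro exI[of _ 1] conjI allI impI)
    fix t :: real assume t: "0 < t" "t < 1"
    show "(w (z + t *\<^sub>R (y - z)) - w z) / t \<le> w y - w z"
      using convex_segment(1)[of z y t] t assms interior_subset_W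
      by (simp add: divide_simps algebra_simps)
  qed simp
  then have "g z \<bullet> (y - z) \<le> w y - w z"
    by (rule tendsto_upperbound[OF directional_derivative[OF assms(1)]]) simp
  then show ?thesis
    by (simp add: bregman_real_def)
qed

text \<open>At the midpoint, strict convexity puts \<open>w\<close> below the average, while the
  subgradient inequality at \<open>z\<close> bounds it from below.\<close>

lemma bregman_real_pos:
  assumes "z \<in> interior W" "y \<in> interior W" "y \<noteq> z"
  shows "0 < D y z"
proof -
  let ?m = "(1/2) *\<^sub>R y + (1 - 1/2) *\<^sub>R z"
  have m: "?m \<in> W"
    using convex_W interior_subset_W assms by (intro convexD) auto
  have "w ?m < 1/2 * w y + (1 - 1/2) * w z"
    using strict[of y z "1/2"] assms by simp
  moreover have "0 \<le> D ?m z"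
    using bregman_real_nonneg[OF assms(1) m] .
  moreover have "?m - z = (1/2) *\<^sub>R (y - z)"
    by (simp add: algebra_simps flip: scaleR_left.add)
  ultimately show ?thesis
    by (simp add: bregman_real_def)
qed

text \<open>If \<open>v\<close> lay on the boundary, the slopes of \<open>w\<close> along the segment from \<open>v\<close> to an
  interior point \<open>p\<close> would be bounded below; with an upper bound for \<open>w\<close> on a ball around \<open>p\<close> the
  subgradient inequality then bounds the gradients along the segment, against \<open>blowup\<close>.\<close>

lemma calm_point_in_interior:
  assumes v: "v \<in> W" and calm: "\<And>y. y \<in> W \<Longrightarrow> w v - K * norm (y - v) \<le> w y"
  shows "v \<in> interior W"
proof (rule ccontr)
  assume "v \<notin> interior W"
  then have fr: "v \<in> frontier W"
    using v closed_W by (simp add: frontier_def)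
  obtain p where p: "p \<in> interior W"
    using interior_W by blast
  have "isCont w p"
    using gderiv[OF p] by (simp add: gderiv_def has_derivative_continuous)
  then have "eventually (\<lambda>u. w u < w p + 1) (nhds p)"
    by (intro order_tendstoD) (auto simp: continuous_at tendsto_at_iff_tendsto_nhds)
  moreover have "eventually (\<lambda>u. u \<in> interior W) (nhds p)"
    using p by (simp add: eventually_nhds_in_open)
  ultimately have "eventually (\<lambda>u. w u < w p + 1 \<and> u \<in> interior W) (nhds p)"
    by (rule eventually_conj)
  then obtain r0 where r0: "r0 > 0" "\<And>u. dist u p < r0 \<Longrightarrow> w u < w p + 1 \<and> u \<in> interior W"
    by (auto simp: eventually_nhds_metric)
  define r where "r = r0 / 2"
  have r: "r > 0" "\<And>u. dist u p \<le> r \<Longrightarrow> w u < w p + 1 \<and> u \<in> W"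
    using r0 interior_subset_W by (auto simp: r_def)
  define K' where "K' = \<bar>K\<bar> * norm (p - v)"
  have K': "K' \<ge> 0"
    by (simp add: K'_def)
  define t where "t n = inverse (real (Suc n))" for n
  define z where "z n = v + t n *\<^sub>R (p - v)" for n
  have t: "0 < t n" "t n \<le> 1" for n
    by (auto simp: t_def divide_simps)
  have z: "z n \<in> interior W" for n
  proof -
    have "v - t n *\<^sub>R (v - p) \<in> interior W"
      using mem_interior_closure_convex_shrink[OF convex_W p _ t(1,2)] v closure_subset by blast
    then show ?thesis
      by (simp add: z_def algebra_simps)
  qed
  have wz: "w v - K' * t n \<le> w (z n)" for n
  proof -
    have "norm (z n - v) = t n * norm (p - v)"
      using t[of n] by (simp add: z_def)
    then have "w v - K * (t n * norm (p - v)) \<le> w (z n)"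
      using calm[of "z n"] z interior_subset_W by metis
    moreover have "K * (t n * norm (p - v)) \<le> \<bar>K\<bar> * (t n * norm (p - v))"
      using t[of n] by (intro mult_right_mono) auto
    ultimately show ?thesis
      by (simp add: K'_def algebra_simps)
  qed
  have slope: "- K' \<le> g (z n) \<bullet> (p - v)" for n
  proof -
    \<comment> \<open>The subgradient inequality at \<open>z n\<close> is tested at
      \<open>v\<close>, where \<open>v - z n\<close> is \<open>- t n\<close> times
      \<open>p - v\<close>.\<close>
    have "0 \<le> D v (z n)"
      using bregman_real_nonneg z v by blast
    then have "w (z n) - w v \<le> t n * (g (z n) \<bullet> (p - v))"
      by (simp add: bregman_real_def z_def)
    then have "t n * (- K') \<le> t n * (g (z n) \<bullet> (p - v))"
      using wz[of n] by (simp add: algebra_simps)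
    then show ?thesis
      using t[of n] by (simp only: mult_le_cancel_left_pos)
  qed
  define M where "M = (w p + 1 - w v + 2 * K') / r"
  have bound: "norm (g (z n)) \<le> M" for n
  proof -
    \<comment> \<open>Moving from \<open>p\<close> by \<open>r\<close> along the gradient turns the
      inner product into \<open>r * norm (g (z n))\<close>. For a zero gradient the quotient is 0
      and \<open>u = p\<close>.\<close>
    define u where "u = p + (r / norm (g (z n))) *\<^sub>R g (z n)"
    have u: "w u < w p + 1" "u \<in> W"
      using r by (auto simp: u_def dist_norm)
    have "0 \<le> D u (z n)"
      using bregman_real_nonneg z u by blast
    moreover have "u - z n = (u - p) + (1 - t n) *\<^sub>R (p - v)"
      by (simp add: z_def algebra_simps)
    moreover have "g (z n) \<bullet> (u - p) = r * norm (g (z n))"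
      by (cases "g (z n) = 0") (auto simp: u_def dot_square_norm power2_eq_square)
    ultimately have 1: "r * norm (g (z n)) + (1 - t n) * (g (z n) \<bullet> (p - v)) \<le> w u - w (z n)"
      by (simp add: bregman_real_def inner_add_right)
    have "(1 - t n) * (- K') \<le> (1 - t n) * (g (z n) \<bullet> (p - v))"
      using slope[of n] t[of n] by (intro mult_left_mono) auto
    then have "r * norm (g (z n)) \<le> w p + 1 - w v + K' * t n + (1 - t n) * K'"
      using 1 u wz[of n] by simp
    also have "\<dots> \<le> w p + 1 - w v + 2 * K'"
      using K' by (simp add: algebra_simps)
    finally show ?thesis
      using r by (simp add: M_def field_simps)
  qed
  have "t \<longlonglongrightarrow> 0"
    unfolding t_def by (rule LIMSEQ_inverse_real_of_nat)
  then have "z \<longlonglongrightarrow> v + 0 *\<^sub>R (p - v)"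
    unfolding z_def by (intro tendsto_intros)
  then have "filterlim (\<lambda>k. norm (g (z k))) at_top sequentially"
    using blowup[OF z fr] by simp
  then have "eventually (\<lambda>k. norm (g (z k)) > M) sequentially"
    by (simp add: filterlim_at_top_dense)
  then show False
    using bound by (auto simp: eventually_sequentially not_less[symmetric])
qed

definition prox_point :: "('a \<Rightarrow> real) \<Rightarrow> real \<Rightarrow> 'a \<Rightarrow> 'a \<Rightarrow> bool" where
  "prox_point h l x v \<longleftrightarrow> v \<in> W \<and> (\<forall>y\<in>W. h v + l * D v x \<le> h y + l * D y x)"

text \<open>Minimality and the Lipschitz bound on \<open>h\<close> let \<open>w\<close> fall away
  from \<open>v\<close> at most linearly, with slope \<open>K / l + norm (g x)\<close>; boundary
  points do not allow this.\<close>

lemma prox_point_interior: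
  assumes l: "l > 0" and lip: "K-lipschitz_on W h" and v: "prox_point h l x v"
  shows "v \<in> interior W"
proof (rule calm_point_in_interior)
  show vW: "v \<in> W"
    using v by (simp add: prox_point_def)
  fix y assume y: "y \<in> W"
  have "h v + l * D v x \<le> h y + l * D y x"
    using v y by (simp add: prox_point_def)
  then have "l * (w v - w y) \<le> (h y - h v) - l * (g x \<bullet> (y - v))"
    by (simp add: bregman_real_def algebra_simps)
  also have "\<dots> \<le> K * norm (y - v) + l * (norm (g x) * norm (y - v))"
  proof -
    have "h y - h v \<le> K * norm (y - v)"
      using lipschitz_onD[OF lip y vW] by (simp add: dist_norm)
    moreover have "- (g x \<bullet> (y - v)) \<le> norm (g x) * norm (y - v)"
      using Cauchy_Schwarz_ineq2[of "g x" "y - v"] by linarith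
    then have "l * (- (g x \<bullet> (y - v))) \<le> l * (norm (g x) * norm (y - v))"
      using l by (intro mult_left_mono) auto
    ultimately show ?thesis
      by simp
  qed
  finally show "w v - (K / l + norm (g x)) * norm (y - v) \<le> w y"
    using l by (simp add: field_simps)
qed

text \<open>First-order optimality without derivatives of \<open>h\<close>: \<open>v\<close> is
  compared with points of the segment towards \<open>y\<close>, the comparison is divided by the
  step \<open>t\<close>, and \<open>t\<close> tends to 0. Since \<open>v\<close> is interior, the
  quotients of \<open>w\<close> tend to \<open>g v \<bullet> (y - v)\<close>.\<close>

lemma prox_point_three_point:
  assumes l: "l > 0" and lip: "K-lipschitz_on W h" and conv: "convex_on W h"
    and v: "prox_point h l x v" and y: "y \<in> W"
  shows "h v + l * D v x + l * D y v \<le> h y + l * D y x"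
proof -
  have vi: "v \<in> interior W"
    using prox_point_interior[OF l lip v] .
  have vW: "v \<in> W"
    using v by (simp add: prox_point_def)
  have ev: "eventually (\<lambda>t. (h v - h y) / l + g x \<bullet> (y - v) \<le> (w (v + t *\<^sub>R (y - v)) - w v) / t)
      (at_right (0::real))"
    unfolding eventually_at_right_field
  proof (intro exI[of _ 1] conjI allI impI)
    fix t :: real assume t: "0 < t" "t < 1"
    let ?y = "v + t *\<^sub>R (y - v)"
    have "h v + l * D v x \<le> h ?y + l * D ?y x"
      using v convex_segment(2)[OF vW y] t by (simp add: prox_point_def)
    moreover have "h ?y \<le> h v + t * (h y - h v)"
    proof -
      have eq: "?y = (1 - t) *\<^sub>R v + t *\<^sub>R y"
        by (simp add: algebra_simps)
      have "h ((1 - t) *\<^sub>R v + t *\<^sub>R y) \<le> (1 - t) * h v + t * h y"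
        using convex_onD[OF conv] vW y t by simp
      then show ?thesis
        unfolding eq by (simp add: algebra_simps)
    qed
    moreover have "?y - x = (v - x) + t *\<^sub>R (y - v)"
      by simp
    then have "D ?y x = D v x + (w ?y - w v - t * (g x \<bullet> (y - v)))"
      unfolding bregman_real_def by (simp only: inner_add_right inner_scaleR_right)
    then have "l * D ?y x = l * D v x + l * (w ?y - w v - t * (g x \<bullet> (y - v)))"
      by (simp only: distrib_left)
    ultimately have "0 \<le> t * (h y - h v) + l * (w ?y - w v - t * (g x \<bullet> (y - v)))"
      by linarith
    then show "(h v - h y) / l + g x \<bullet> (y - v) \<le> (w ?y - w v) / t"
      using l t by (simp add: field_simps)
  qed simp
  have "(h v - h y) / l + g x \<bullet> (y - v) \<le> g v \<bullet> (y - v)"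
    by (rule tendsto_lowerbound[OF directional_derivative[OF vi] ev]) simp
  then have "h v - h y \<le> l * ((g v - g x) \<bullet> (y - v))"
    using l by (simp add: field_simps inner_diff_left)
  also have "\<dots> = l * (D y x - D v x - D y v)"
    by (simp add: bregman_real_three_point)
  finally show ?thesis
    by (simp add: algebra_simps)
qed

text \<open>By the three-point inequality for \<open>v'\<close>, the objective at \<open>v\<close>
  exceeds its minimum by at least \<open>l * D v v'\<close>, which is positive as both points are
  interior.\<close>

lemma prox_point_unique:
  assumes "l > 0" "K-lipschitz_on W h" "convex_on W h" "prox_point h l x v" "prox_point h l x v'"
  shows "v = v'"
proof (rule ccontr)
  assume "v \<noteq> v'"
  then have "0 < l * D v v'"
    using bregman_real_pos prox_point_interior assms by simp
  moreover have "v \<in> W" "h v + l * D v x \<le> h v' + l * D v' x"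
    using assms(4,5) by (auto simp: prox_point_def)
  ultimately show False
    using prox_point_three_point[OF assms(1,2,3,5), of v] by linarith
qed

text \<open>The minimisation is lifted to the epigraph of \<open>w\<close>, on which the objective is continuous although
  \<open>w\<close> itself is only lower semicontinuous up to the boundary.\<close>

lemma prox_point_exists:
  assumes l: "l > 0" and lip: "K-lipschitz_on W h" and x: "x \<in> interior W"
  shows "\<exists>v. prox_point h l x v"
proof -
  have xW: "x \<in> W"
    using x interior_subset_W by blast
  define E where "E = {(y, s). y \<in> W \<and> w y \<le> s}"
  define \<psi> where "\<psi> q = h (fst q) + l * (snd q - g x \<bullet> fst q)" for q :: "'a \<times> real"
  have contE: "continuous_on E \<psi>"
  proof -
    have "continuous_on (fst ` E) h"
      using lipschitz_on_continuous_on[OF lip] by (rule continuous_on_subset) (auto simp: E_def)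
    then have "continuous_on E (\<lambda>q. h (fst q))"
      by (intro continuous_on_compose2[of "fst ` E" h E fst] continuous_intros) auto
    then show ?thesis
      unfolding \<psi>_def by (intro continuous_intros)
  qed
  have "closed E"
    using closed_epigraph by (simp add: E_def)
  have "closed {q \<in> E. \<psi> q \<le> \<psi> (x, w x)}"
  proof -
    have "{q \<in> E. \<psi> q \<le> \<psi> (x, w x)} = E \<inter> \<psi> -` {..\<psi> (x, w x)}"
      by blast
    then show ?thesis
      using continuous_closed_preimage[OF contE \<open>closed E\<close> closed_atMost] by metis
  qed
  moreover have "bounded {q \<in> E. \<psi> q \<le> \<psi> (x, w x)}"
  proof -
    \<comment> \<open>Growth of slope \<open>N\<close> outweighs the Lipschitz growth of
      \<open>h\<close> and the linear term of the distance, and leaves \<open>l * norm y\<close>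
      over.\<close>
    define N where "N = K / l + norm (g x) + 1"
    obtain B where B: "\<And>y. y \<in> W \<Longrightarrow> B \<le> norm y \<Longrightarrow> N * norm y \<le> w y"
      using coercive by blast
    have growth: "l * norm y \<le> h y - h x + K * norm x + l * (w y - g x \<bullet> y)"
      if y: "y \<in> W" "B \<le> norm y" for y
    proof -
      have "l * (N * norm y) \<le> l * w y"
        using B[OF y] l by simp
      moreover have "l * (N * norm y) = K * norm y + l * (norm (g x) * norm y) + l * norm y"
        using l by (simp add: N_def field_simps)
      moreover have "l * (g x \<bullet> y) \<le> l * (norm (g x) * norm y)"
        using l norm_cauchy_schwarz by (intro mult_left_mono) auto
      moreover have "h x - h y \<le> K * norm (x - y)"
        using lipschitz_onD[OF lip xW y(1)] by (simp add: dist_norm)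
      moreover have "K * norm (x - y) \<le> K * (norm x + norm y)"
        using lipschitz_on_nonneg[OF lip] norm_triangle_ineq4 by (intro mult_left_mono) auto
      ultimately show ?thesis
        by (simp add: algebra_simps)
    qed
    \<comment> \<open>Beyond radius \<open>B\<close> the second entry bounds the norm, by
      \<open>growth\<close>.\<close>
    define R where "R = max B ((K * norm x + l * (w x - g x \<bullet> x)) / l)"
    define R' where "R' = (l * (w x - g x \<bullet> x) + K * (norm x + R)) / l + norm (g x) * R"
    \<comment> \<open>The sublevel inequality gives the upper bound on the second coordinate; the
      lower bound comes from \<open>w y \<le> s\<close> and the subgradient inequality at
      \<open>x\<close>.\<close>
    have "norm (fst q) \<le> R \<and> - (\<bar>w x\<bar> + norm (g x) * (R + norm x)) \<le> snd q \<and> snd q \<le> R'"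
      if q: "q \<in> E" "\<psi> q \<le> \<psi> (x, w x)" for q
    proof -
      obtain y s where ys: "q = (y, s)" "y \<in> W" "w y \<le> s"
        using q by (cases q) (auto simp: E_def)
      have le: "h y + l * (s - g x \<bullet> y) \<le> h x + l * (w x - g x \<bullet> x)"
        using q by (simp add: \<psi>_def ys)
      have "l * w y \<le> l * s"
        using ys l by simp
      have yR: "norm y \<le> R"
      proof (cases "B \<le> norm y")
        case True
        have "l * norm y \<le> K * norm x + l * (w x - g x \<bullet> x)"
          using growth[OF ys(2) True] le \<open>l * w y \<le> l * s\<close> by (simp add: algebra_simps)
        then have "norm y \<le> (K * norm x + l * (w x - g x \<bullet> x)) / l"
          using l by (simp add: field_simps)
        then show ?thesis
          by (simp add: R_def)
      qed (auto simp: R_def)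
      have "h x - h y \<le> K * norm (x - y)"
        using lipschitz_onD[OF lip xW ys(2)] by (simp add: dist_norm)
      also have "\<dots> \<le> K * (norm x + R)"
        using lipschitz_on_nonneg[OF lip] norm_triangle_ineq4[of x y] yR
        by (intro mult_left_mono) auto
      finally have "l * (s - g x \<bullet> y) \<le> l * (w x - g x \<bullet> x) + K * (norm x + R)"
        using le by simp
      then have "s - g x \<bullet> y \<le> (l * (w x - g x \<bullet> x) + K * (norm x + R)) / l"
        using l by (simp add: pos_le_divide_eq mult.commute)
      moreover have "\<bar>g x \<bullet> z\<bar> \<le> norm (g x) * S" if "norm z \<le> S" for z S
        using Cauchy_Schwarz_ineq2[of "g x" z] that mult_left_mono[of "norm z" S "norm (g x)"]
        by simp
      from this[OF yR] this[of "y - x" "R + norm x"]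
      have "g x \<bullet> y \<le> norm (g x) * R" "- (norm (g x) * (R + norm x)) \<le> g x \<bullet> (y - x)"
        using norm_triangle_ineq4[of y x] yR by auto
      moreover have "0 \<le> D y x"
        using bregman_real_nonneg[OF x ys(2)] .
      ultimately show ?thesis
        using yR ys(3) unfolding ys(1) R'_def bregman_real_def fst_conv snd_conv by linarith
    qed
    then have "{q \<in> E. \<psi> q \<le> \<psi> (x, w x)}
        \<subseteq> cball 0 R \<times> {- (\<bar>w x\<bar> + norm (g x) * (R + norm x))..R'}"
      by (auto simp: dist_norm)
    then show ?thesis
      by (rule bounded_subset[rotated]) (intro bounded_Times bounded_cball bounded_closed_interval)
  qed
  ultimately have comp: "compact {q \<in> E. \<psi> q \<le> \<psi> (x, w x)}"
    by (simp add: compact_eq_bounded_closed)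
  have xE: "(x, w x) \<in> {q \<in> E. \<psi> q \<le> \<psi> (x, w x)}"
    using xW by (simp add: E_def)
  obtain q where q: "q \<in> E" "\<psi> q \<le> \<psi> (x, w x)"
      "\<And>q'. q' \<in> E \<Longrightarrow> \<psi> q' \<le> \<psi> (x, w x) \<Longrightarrow> \<psi> q \<le> \<psi> q'"
    using continuous_attains_inf[OF comp _ continuous_on_subset[OF contE]] xE by blast
  \<comment> \<open>Passing from \<open>(y, s)\<close> down to \<open>(y, w y)\<close> never raises
    \<open>\<psi>\<close>, so a minimiser over the epigraph yields one over
    \<open>W\<close>.\<close>
  have "prox_point h l x (fst q)"
    unfolding prox_point_def
  proof (intro conjI ballI)
    show "fst q \<in> W"
      using q(1) by (auto simp: E_def)
    fix y assume y: "y \<in> W"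
    have "\<psi> q \<le> \<psi> (y, w y)"
    proof (cases "\<psi> (y, w y) \<le> \<psi> (x, w x)")
      case True
      then show ?thesis
        using q(3)[of "(y, w y)"] y by (simp add: E_def)
    next
      case False
      then show ?thesis
        using q(2) by simp
    qed
    moreover have "l * w (fst q) \<le> l * snd q"
      using q(1) l by (auto simp: E_def)
    ultimately show "h (fst q) + l * D (fst q) x \<le> h y + l * D y x"
      by (simp add: \<psi>_def bregman_real_def algebra_simps)
  qed
  then show ?thesis ..
qed

end


section \<open>Ordering cones and their dual bases\<close>

lemma dual_base_subset_dual_cone: "dual_base C \<subseteq> dual_cone C"
  unfolding dual_base_def
proof (rule hull_minimal)
  show "convex (dual_cone C)"
    by (auto simp: convex_def dual_cone_def inner_add_left)
qed auto

lemma dual_base_inner_nonneg: "c \<in> dual_base C \<Longrightarrow> y \<in> C \<Longrightarrow> 0 \<le> c \<bullet> y"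
  using dual_base_subset_dual_cone by (auto simp: dual_cone_def)

lemma norm_dual_base_le: "c \<in> dual_base C \<Longrightarrow> norm c \<le> 1"
proof -
  have "dual_base C \<subseteq> cball 0 1"
    unfolding dual_base_def by (rule hull_minimal) auto
  then show "c \<in> dual_base C \<Longrightarrow> norm c \<le> 1"
    by auto
qed

lemma ordering_cone_add: "ordering_cone C \<Longrightarrow> y \<in> C \<Longrightarrow> z \<in> C \<Longrightarrow> y + z \<in> C"
  by (metis convex_cone ordering_cone_def)

lemma ordering_cone_zero: "ordering_cone C \<Longrightarrow> 0 \<in> C"
  unfolding ordering_cone_def by auto

text \<open>A hyperplane strictly separating \<open>y\<close> from \<open>C\<close> has its normal
  in the dual cone because \<open>C\<close> is closed under scaling; the normal is nonzero, as
  \<open>b < 0\<close>, and can be normalised.\<close>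

lemma dual_base_separates:
  fixes C :: "'a::euclidean_space set"
  assumes C: "ordering_cone C" and y: "y \<notin> C"
  shows "\<exists>c\<in>dual_base C. c \<bullet> y < 0"
proof -
  have "convex C" "closed C" "cone C"
    using C by (auto simp: ordering_cone_def)
  then obtain a b where a: "a \<bullet> y < b" "\<And>z. z \<in> C \<Longrightarrow> b < a \<bullet> z"
    using separating_hyperplane_closed_point[of C y] y by blast
  have b: "b < 0"
    using a(2)[OF ordering_cone_zero[OF C]] by simp
  have "0 \<le> a \<bullet> z" if z: "z \<in> C" for z
  proof (rule ccontr)
    assume "\<not> 0 \<le> a \<bullet> z"
    then have neg: "a \<bullet> z < 0"
      by simp
    \<comment> \<open>Both \<open>b\<close> and \<open>a \<bullet> z\<close> are negative, so the
      factor is positive; the scaled point lies exactly on the hyperplane.\<close>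
    have "(b / (a \<bullet> z)) *\<^sub>R z \<in> C"
      using \<open>cone C\<close> z b neg by (auto simp: cone_def divide_nonpos_neg)
    from a(2)[OF this] show False
      using neg by simp
  qed
  moreover have "a \<noteq> 0"
    using a(1) b by auto
  ultimately have "(1 / norm a) *\<^sub>R a \<in> dual_base C"
    unfolding dual_base_def by (intro hull_inc) (auto simp: dual_cone_def)
  moreover have "((1 / norm a) *\<^sub>R a) \<bullet> y < 0"
    using a(1) b \<open>a \<noteq> 0\<close> by (simp add: divide_neg_pos)
  ultimately show ?thesis ..
qed

text \<open>The bipolar theorem for normalised functionals, which reduces cone inequalities to
  scalar ones.\<close>

lemma ordering_cone_mem_iff:
  fixes C :: "'a::euclidean_space set"
  assumes "ordering_cone C"
  shows "y \<in> C \<longleftrightarrow> (\<forall>c\<in>dual_base C. 0 \<le> c \<bullet> y)"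
  using dual_base_separates[OF assms] dual_base_inner_nonneg by fastforce

text \<open>An empty base would make \<open>C\<close> the whole space, against pointedness.\<close>

lemma dual_base_nonempty:
  fixes C :: "'a::euclidean_space set"
  assumes "ordering_cone C"
  shows "dual_base C \<noteq> {}"
proof
  assume "dual_base C = {}"
  then have "C = UNIV"
    using ordering_cone_mem_iff[OF assms] by auto
  moreover have "C \<inter> uminus ` C = {0}"
    using assms by (simp add: ordering_cone_def)
  moreover obtain b :: 'a where "b \<in> Basis"
    using nonempty_Basis by blast
  ultimately have "b = 0" "b \<in> Basis"
    by (auto simp: surj_def)
  then show False
    using nonzero_Basis by blast
qed

text \<open>A unit functional \<open>c\<close> of the dual cone, tested at \<open>y\<close> minus
  \<open>r\<close> times \<open>c\<close>, is at least \<open>r\<close> at \<open>y\<close>;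
  half-spaces are convex, so the bound passes to the hull.\<close>

lemma dual_base_interior_bound:
  fixes y :: "'a::euclidean_space"
  assumes "y \<in> interior C"
  shows "\<exists>\<delta>>0. \<forall>c\<in>dual_base C. \<delta> \<le> c \<bullet> y"
proof -
  obtain r where r: "r > 0" "cball y r \<subseteq> C"
    using assms mem_interior_cball by blast
  have "dual_base C \<subseteq> {c. r \<le> c \<bullet> y}"
    unfolding dual_base_def
  proof (rule hull_minimal)
    show "{c \<in> dual_cone C. norm c = 1} \<subseteq> {c. r \<le> c \<bullet> y}"
    proof safe
      fix c assume c: "c \<in> dual_cone C" "norm c = 1"
      have "y - r *\<^sub>R c \<in> C"
        using r c by (auto simp: dist_norm)
      then have "0 \<le> c \<bullet> (y - r *\<^sub>R c)"
        using c by (simp add: dual_cone_def)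
      then show "r \<le> c \<bullet> y"
        using c by (simp add: inner_diff_right dot_square_norm)
    qed
    show "convex {c. r \<le> c \<bullet> y}"
      using convex_halfspace_ge[of r y] by (simp add: inner_commute)
  qed
  then show ?thesis
    using r by blast
qed

text \<open>This normalisation lets the vector term along \<open>e\<close> in relative smoothness be
  bounded by its scalar coefficient.\<close>

lemma scaling_vector_inner_le_1:
  fixes C :: "'a::euclidean_space set"
  assumes "scaling_vector C r e" "c \<in> dual_base C"
  shows "c \<bullet> e \<le> 1"
proof -
  have "bdd_above ((\<lambda>c. c \<bullet> e) ` dual_base C)"
  proof (rule bdd_aboveI2)
    fix c assume "c \<in> dual_base C"
    then have "norm c * norm e \<le> 1 * norm e"
      by (intro mult_right_mono norm_dual_base_le) auto
    then show "c \<bullet> e \<le> norm e"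
      using norm_cauchy_schwarz[of c e] by linarith
  qed
  then have "c \<bullet> e \<le> (SUP c\<in>dual_base C. c \<bullet> e)"
    using assms(2) by (rule cSUP_upper[rotated])
  then show ?thesis
    using assms(1) by (simp add: scaling_vector_def)
qed

section \<open>Monotone sequences in the cone order and quasi-Fejer sequences\<close>

lemma cone_antimono:
  fixes u :: "nat \<Rightarrow> 'a::real_normed_vector"
  assumes C: "ordering_cone C" and dec: "\<And>k. u k - u (Suc k) \<in> C" and "m \<le> n"
  shows "u m - u n \<in> C"
  using \<open>m \<le> n\<close>
proof (induction n rule: dec_induct)
  case base
  then show ?case
    by (simp add: ordering_cone_zero[OF C])
next
  case (step n)
  from ordering_cone_add[OF C step.IH dec[of n]] show ?case
    by simp
qed

text \<open>Closedness of \<open>C\<close> places every subsequential limit below all terms. Two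
  such limits are thus comparable in both directions and coincide by pointedness; a bounded sequence
  with one accumulation point converges.\<close>

lemma cone_decseq_convergent:
  fixes C :: "'a::euclidean_space set" and u :: "nat \<Rightarrow> 'a"
  assumes C: "ordering_cone C" and dec: "\<And>k. u k - u (Suc k) \<in> C" and bdd: "bounded (range u)"
  shows "\<exists>l. u \<longlonglongrightarrow> l \<and> (\<forall>k. u k - l \<in> C)"
proof -
  note antimono = cone_antimono[where u = u, OF C dec]
  have below: "u k - l \<in> C" if s: "strict_mono s" "(u \<circ> s) \<longlonglongrightarrow> l" for s l k
  proof -
    have "closed C"
      using C by (simp add: ordering_cone_def)
    moreover have "(\<lambda>n. u k - u (s n)) \<longlonglongrightarrow> u k - l"
      using s(2) by (intro tendsto_intros) (simp add: o_def)
    moreover have "eventually (\<lambda>n. u k - u (s n) \<in> C) sequentially"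
      unfolding eventually_sequentially
      using antimono seq_suble[OF s(1)] order_trans by blast
    ultimately show ?thesis
      by (intro Lim_in_closed_set[OF _ _ trivial_limit_sequentially])
  qed
  have unique: "l = l'"
    if "strict_mono s" "(u \<circ> s) \<longlonglongrightarrow> l" "strict_mono s'" "(u \<circ> s') \<longlonglongrightarrow> l'" for s s' l l'
  proof -
    have "closed C"
      using C by (simp add: ordering_cone_def)
    have le: "l - l' \<in> C"
      if s: "strict_mono s" "(u \<circ> s) \<longlonglongrightarrow> l" and s': "strict_mono s'" "(u \<circ> s') \<longlonglongrightarrow> l'" for s s' l l'
    proof (rule Lim_in_closed_set[OF \<open>closed C\<close>])
      show "(\<lambda>n. (u \<circ> s) n - l') \<longlonglongrightarrow> l - l'"
        using s(2) by (intro tendsto_intros)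
      show "eventually (\<lambda>n. (u \<circ> s) n - l' \<in> C) sequentially"
        using below[OF s'] by simp
    qed simp
    have "l - l' \<in> C" "l' - l \<in> C"
      using le that by blast+
    then have "l - l' \<in> C \<inter> uminus ` C"
      by (auto intro: image_eqI[of _ _ "l' - l"])
    moreover have "C \<inter> uminus ` C = {0}"
      using C by (simp add: ordering_cone_def)
    ultimately show ?thesis
      by (metis eq_iff_diff_eq_0 singletonD)
  qed
  have subseq: "\<exists>l r. strict_mono r \<and> ((u \<circ> q) \<circ> r) \<longlonglongrightarrow> l" for q :: "nat \<Rightarrow> nat"
    using bounded_imp_convergent_subsequence[of "u \<circ> q"] bdd bounded_subset[of "range u"]
    by (metis image_comp image_mono subset_UNIV)
  obtain s l where s: "strict_mono s" "(u \<circ> s) \<longlonglongrightarrow> l"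
    using subseq[of id] by auto
  have "u \<longlonglongrightarrow> l"
  proof (rule ccontr)
    assume "\<not> u \<longlonglongrightarrow> l"
    then obtain \<epsilon> where \<epsilon>: "\<epsilon> > 0" "\<not> eventually (\<lambda>n. dist (u n) l < \<epsilon>) sequentially"
      by (auto simp: tendsto_iff)
    from not_eventually_sequentiallyD[OF this(2)]
    obtain q :: "nat \<Rightarrow> nat" where q: "strict_mono q" "\<forall>n. \<not> dist (u (q n)) l < \<epsilon>"
      by blast
    obtain r l' where r: "strict_mono r" "((u \<circ> q) \<circ> r) \<longlonglongrightarrow> l'"
      using subseq by blast
    have "l' = l"
      using unique[of "q \<circ> r" l' s l] q(1) r s by (simp add: strict_mono_o o_assoc)
    then have "eventually (\<lambda>n. dist (((u \<circ> q) \<circ> r) n) l < \<epsilon>) sequentially"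
      using tendstoD[OF r(2) \<epsilon>(1)] by simp
    then show False
      using q(2) by (auto simp: eventually_sequentially)
  qed
  then show ?thesis
    using below[OF s] by blast
qed

text \<open>Subtracting the partial sums of \<open>\<beta>\<close> gives a decreasing sequence
  bounded below, so \<open>a\<close> converges; the subsequence identifies the limit.\<close>

lemma quasi_Fejer_tendsto_0:
  fixes a \<beta> :: "nat \<Rightarrow> real"
  assumes step: "\<And>k. a (Suc k) \<le> a k + \<beta> k" and nonneg: "\<And>k. 0 \<le> a k"
    and \<beta>: "summable \<beta>" "\<And>k. 0 \<le> \<beta> k"
    and s: "strict_mono s" "(\<lambda>k. a (s k)) \<longlonglongrightarrow> 0"
  shows "a \<longlonglongrightarrow> 0"
proof -
  define b where "b k = a k - (\<Sum>i<k. \<beta> i)" for k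
  have "decseq b"
    using step by (auto simp: decseq_Suc_iff b_def algebra_simps)
  moreover have "- suminf \<beta> \<le> b k" for k
    using nonneg[of k] sum_le_suminf[OF \<beta>(1), of "{..<k}"] \<beta>(2) by (simp add: b_def)
  ultimately obtain B where B: "b \<longlonglongrightarrow> B"
    using decseq_convergent by metis
  have "(\<lambda>k. b k + (\<Sum>i<k. \<beta> i)) \<longlonglongrightarrow> B + suminf \<beta>"
    using B summable_LIMSEQ[OF \<beta>(1)] by (intro tendsto_intros)
  then have lim: "a \<longlonglongrightarrow> B + suminf \<beta>"
    by (simp add: b_def)
  from LIMSEQ_subseq_LIMSEQ[OF this s(1)] s(2) have "B + suminf \<beta> = 0"
    using LIMSEQ_unique by (auto simp: o_def)
  then show ?thesis
    using lim by simp
qed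

section \<open>Support functions of subsets of the unit ball\<close>

definition support :: "'b::euclidean_space set \<Rightarrow> 'b \<Rightarrow> real" where
  "support H u = (SUP c\<in>H. c \<bullet> u)"

lemma support_singleton [simp]: "support {c} u = c \<bullet> u"
  by (simp add: support_def)

lemma support_least: "H \<noteq> {} \<Longrightarrow> (\<And>c. c \<in> H \<Longrightarrow> c \<bullet> u \<le> b) \<Longrightarrow> support H u \<le> b"
  unfolding support_def by (rule cSUP_least)

lemma support_upper:
  assumes "H \<subseteq> cball 0 1" "c \<in> H"
  shows "c \<bullet> u \<le> support H u"
proof -
  have "c \<bullet> u \<le> norm u" if "c \<in> H" for c
  proof -
    have "norm c * norm u \<le> 1 * norm u"
      using assms that by (intro mult_right_mono) auto
    then show ?thesis
      using norm_cauchy_schwarz[of c u] by linarith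
  qed
  then have "bdd_above ((\<lambda>c. c \<bullet> u) ` H)"
    by (intro bdd_aboveI2)
  then show ?thesis
    unfolding support_def using assms(2) by (rule cSUP_upper[rotated])
qed

lemma support_diff_le:
  assumes "H \<noteq> {}" "H \<subseteq> cball 0 1"
  shows "support H u \<le> support H v + norm (u - v)"
proof (rule support_least[OF assms(1)])
  fix c assume c: "c \<in> H"
  have "norm c * norm (u - v) \<le> 1 * norm (u - v)"
    using assms c by (intro mult_right_mono) auto
  then have "c \<bullet> (u - v) \<le> norm (u - v)"
    using norm_cauchy_schwarz[of c "u - v"] by linarith
  then show "c \<bullet> u \<le> support H v + norm (u - v)"
    using support_upper[OF assms(2) c, of v] by (simp add: inner_diff_right)
qed

lemma lipschitz_on_support_linear:
  assumes H: "H \<noteq> {}" "H \<subseteq> cball 0 1" and A: "bounded_linear A"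
  shows "(onorm A)-lipschitz_on S (\<lambda>y. support H (A (y - x)))"
proof (rule lipschitz_onI)
  fix y z
  have "A (y - x) - A (z - x) = A (y - z)" "A (z - x) - A (y - x) = A (z - y)"
    using A by (simp_all add: bounded_linear.linear flip: linear_diff)
  moreover have "norm (A (y - z)) \<le> onorm A * norm (y - z)" "norm (A (z - y)) \<le> onorm A * norm (y - z)"
    using onorm[OF A, of "y - z"] onorm[OF A, of "z - y"] by (simp_all add: norm_minus_commute)
  ultimately show "dist (support H (A (y - x))) (support H (A (z - x))) \<le> onorm A * dist y z"
    using support_diff_le[OF H, of "A (y - x)" "A (z - x)"] support_diff_le[OF H, of "A (z - x)" "A (y - x)"]
    by (simp add: dist_norm)
qed (rule onorm_pos_le[OF A])

lemma convex_on_support_linear: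
  assumes H: "H \<noteq> {}" "H \<subseteq> cball 0 1" and A: "linear A" and S: "convex S"
  shows "convex_on S (\<lambda>y. support H (A (y - x)))"
proof (rule convex_onI)
  fix t :: real and y z assume t: "0 < t" "t < 1"
  have eq: "(1 - t) *\<^sub>R y + t *\<^sub>R z - x = (1 - t) *\<^sub>R (y - x) + t *\<^sub>R (z - x)"
    by (simp add: algebra_simps)
  show "support H (A ((1 - t) *\<^sub>R y + t *\<^sub>R z - x))
      \<le> (1 - t) * support H (A (y - x)) + t * support H (A (z - x))"
  proof (rule support_least[OF H(1)])
    fix c assume c: "c \<in> H"
    have "c \<bullet> A ((1 - t) *\<^sub>R y + t *\<^sub>R z - x) = (1 - t) * (c \<bullet> A (y - x)) + t * (c \<bullet> A (z - x))"
      unfolding eq using A by (simp add: linear_add linear_scale inner_add_right)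
    also have "\<dots> \<le> (1 - t) * support H (A (y - x)) + t * support H (A (z - x))"
      using t by (intro add_mono mult_left_mono support_upper[OF H(2) c]) auto
    finally show "c \<bullet> A ((1 - t) *\<^sub>R y + t *\<^sub>R z - x)
      \<le> (1 - t) * support H (A (y - x)) + t * support H (A (z - x))" .
  qed
qed (rule S)

section \<open>Runs of the method\<close>

text \<open>\<open>J\<close> stands for the Jacobian: \<open>J_le\<close> is the gradient inequality
  of \<open>C\<close>-convexity, \<open>J_ge\<close> is relative smoothness, and \<open>sym\<close>
  states the symmetry coefficient without division.\<close>

locale interior_bregman = legendre_real W w g
  for W :: "'a::euclidean_space set" and w g +
  fixes C :: "'b::euclidean_space set" and e :: 'b and F :: "'a \<Rightarrow> 'b" and J :: "'a \<Rightarrow> 'a \<Rightarrow> 'b"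
    and L l \<alpha> :: real and x :: "nat \<Rightarrow> 'a"
  assumes C: "ordering_cone C"
    and e: "c \<in> dual_base C \<Longrightarrow> c \<bullet> e \<le> 1"
    and F: "continuous_on UNIV F"
    and J: "linear (J p)"
    and J_le: "\<lbrakk>p \<in> interior W; y \<in> W\<rbrakk> \<Longrightarrow> F y - F p - J p (y - p) \<in> C"
    and J_ge: "\<lbrakk>p \<in> interior W; y \<in> interior W\<rbrakk>
      \<Longrightarrow> F p + J p (y - p) + (L * bregman_real w g y p) *\<^sub>R e - F y \<in> C"
    and L: "L > 0" and \<alpha>: "\<alpha> \<ge> 0" and l: "L / (1 + \<alpha>) < l"
    and sym: "\<lbrakk>p \<in> interior W; y \<in> interior W\<rbrakk>
      \<Longrightarrow> \<alpha> * bregman_real w g y p \<le> bregman_real w g p y"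
    and bounded_sublevel: "bounded {z. F (x 0) - F z \<in> C}"
    and x0: "x 0 \<in> interior W"
    and x_Suc: "prox_point (\<lambda>y. support (dual_base C) (J (x k) (y - x k))) l (x k) (x (Suc k))"
begin

lemma l_pos: "l > 0"
  using l L \<alpha> by (smt (verit) divide_pos_pos)

text \<open>\<open>H\<close> is a parameter because the whole dual base gives the subproblem of the
  method, and a singleton that of one multiplier.\<close>

abbreviation model where "model H p y \<equiv> support H (J p (y - p))"

lemma model_lipschitz:
  "\<lbrakk>H \<noteq> {}; H \<subseteq> dual_base C\<rbrakk> \<Longrightarrow> (onorm (J p))-lipschitz_on W (model H p)"
  using norm_dual_base_le J
  by (intro lipschitz_on_support_linear linear_conv_bounded_linear[THEN iffD1]) fastforce+

lemma model_convex: "\<lbrakk>H \<noteq> {}; H \<subseteq> dual_base C\<rbrakk> \<Longrightarrow> convex_on W (model H p)"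
  using norm_dual_base_le J convex_W by (intro convex_on_support_linear) fastforce+

lemmas prox_model_interior = prox_point_interior[OF l_pos model_lipschitz]

lemma prox_model_three_point:
  "\<lbrakk>H \<noteq> {}; H \<subseteq> dual_base C; prox_point (model H p) l p v; y \<in> W\<rbrakk>
    \<Longrightarrow> model H p v + l * D v p + l * D y v \<le> model H p y + l * D y p"
  by (rule prox_point_three_point[OF l_pos model_lipschitz model_convex])

text \<open>For each \<open>c\<close>, \<open>J_le\<close> bounds the linear term at
  \<open>y\<close> by the change of \<open>F\<close>, and \<open>J_ge\<close> with
  \<open>c \<bullet> e \<le> 1\<close> bounds \<open>F v\<close> by the linear term at
  \<open>v\<close> plus \<open>L * D v p\<close>. As \<open>\<delta>\<close> is uniform in
  \<open>c\<close>, the combination survives the supremum and enters the three-point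
  inequality.\<close>

lemma step_estimate:
  assumes H: "H \<noteq> {}" "H \<subseteq> dual_base C" and p: "p \<in> interior W"
    and v: "prox_point (model H p) l p v" and y: "y \<in> W"
    and \<delta>: "\<And>c. c \<in> H \<Longrightarrow> \<delta> \<le> c \<bullet> (F v - F y)"
  shows "\<delta> + l * D y v \<le> l * D y p + (L - l) * D v p"
proof -
  have vi: "v \<in> interior W"
    using prox_model_interior[OF H v] .
  have H1: "H \<subseteq> cball 0 1"
    using H norm_dual_base_le by fastforce
  have "model H p y \<le> model H p v + L * D v p - \<delta>"
  proof (rule support_least[OF H(1)])
    fix c assume c: "c \<in> H"
    then have cG: "c \<in> dual_base C"
      using H by blast
    have "0 \<le> c \<bullet> (F y - F p - J p (y - p))"
      using dual_base_inner_nonneg[OF cG J_le[OF p y]] .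
    moreover have "0 \<le> c \<bullet> (F p + J p (v - p) + (L * D v p) *\<^sub>R e - F v)"
      using dual_base_inner_nonneg[OF cG J_ge[OF p vi]] .
    moreover have "L * D v p * (c \<bullet> e) \<le> L * D v p"
      using e[OF cG] L bregman_real_nonneg[OF p interior_subset_W[OF vi]]
      by (intro mult_left_le) auto
    ultimately show "c \<bullet> J p (y - p) \<le> model H p v + L * D v p - \<delta>"
      using \<delta>[OF c] support_upper[OF H1 c, of "J p (v - p)"]
      by (simp add: inner_diff_right inner_add_right)
  qed
  then show ?thesis
    using prox_model_three_point[OF H v y] by (simp add: algebra_simps)
qed

section \<open>Descent, boundedness and summability along the run\<close>

lemma x_interior: "x k \<in> interior W"
proof (induction k)
  case (Suc k)
  show ?case
    using prox_model_interior[OF dual_base_nonempty[OF C] order_refl x_Suc] .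
qed (rule x0)

lemma x_in_W: "x k \<in> W"
  using x_interior interior_subset_W by blast

abbreviation d where "d k \<equiv> D (x (Suc k)) (x k)"

lemma d_nonneg: "0 \<le> d k"
  using bregman_real_nonneg x_interior x_in_W by blast

text \<open>The three-point inequality at \<open>y = x k\<close> contributes the reversed distance
  \<open>D (x k) (x (Suc k))\<close>, which brings in the symmetry coefficient.\<close>

lemma sufficient_decrease:
  assumes c: "c \<in> dual_base C"
  shows "(l * (1 + \<alpha>) - L) * d k \<le> c \<bullet> (F (x k) - F (x (Suc k)))"
proof -
  let ?G = "dual_base C" and ?p = "x k" and ?v = "x (Suc k)"
  have G: "?G \<noteq> {}" "?G \<subseteq> ?G"
    using dual_base_nonempty[OF C] by auto
  have G1: "?G \<subseteq> cball 0 1"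
    using norm_dual_base_le by fastforce
  have "model ?G ?p ?v + l * D ?v ?p + l * D ?p ?v \<le> model ?G ?p ?p + l * D ?p ?p"
    using prox_model_three_point[OF G x_Suc x_in_W] .
  moreover have "model ?G ?p ?p = 0"
    using G J by (simp add: linear_0 support_def)
  moreover have "D ?p ?p = 0"
    by (simp add: bregman_real_def)
  moreover have "c \<bullet> J ?p (?v - ?p) \<le> model ?G ?p ?v"
    using support_upper[OF G1 c] .
  moreover have "0 \<le> c \<bullet> (F ?p + J ?p (?v - ?p) + (L * d k) *\<^sub>R e - F ?v)"
    using dual_base_inner_nonneg[OF c J_ge[OF x_interior x_interior]] .
  moreover have "L * d k * (c \<bullet> e) \<le> L * d k"
    using e[OF c] L d_nonneg by (intro mult_left_le) auto
  moreover have "l * (\<alpha> * d k) \<le> l * D ?p ?v"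
    using sym[OF x_interior x_interior] l_pos by simp
  ultimately show ?thesis
    by (simp add: inner_diff_right inner_add_right algebra_simps)
qed

lemma decrease_coeff_pos: "0 < l * (1 + \<alpha>) - L"
  using l \<alpha> by (simp add: pos_divide_less_eq)

lemma F_decreasing: "F (x k) - F (x (Suc k)) \<in> C"
  unfolding ordering_cone_mem_iff[OF C]
proof
  fix c assume c: "c \<in> dual_base C"
  have "0 \<le> (l * (1 + \<alpha>) - L) * d k"
    using decrease_coeff_pos d_nonneg by simp
  then show "0 \<le> c \<bullet> (F (x k) - F (x (Suc k)))"
    using sufficient_decrease[OF c] by (rule order_trans)
qed

lemmas F_antimono = cone_antimono[where u = "\<lambda>k. F (x k)", OF C F_decreasing]

lemma bounded_x: "bounded (range x)"
  by (rule bounded_subset[OF bounded_sublevel]) (auto intro: F_antimono)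

definition F_lim where "F_lim = lim (\<lambda>k. F (x k))"

text \<open>Continuity on the compact closure of the run bounds the values of \<open>F\<close>, so
  this cone-monotone sequence converges.\<close>

lemma F_lim: "(\<lambda>k. F (x k)) \<longlonglongrightarrow> F_lim" "F (x k) - F_lim \<in> C"
proof -
  have "compact (closure (range x))"
    using bounded_x by (simp add: compact_closure)
  then have "compact (F ` closure (range x))"
    using F by (intro compact_continuous_image continuous_on_subset[OF F]) auto
  moreover have "range (\<lambda>k. F (x k)) \<subseteq> F ` closure (range x)"
    using closure_subset by fastforce
  ultimately have "bounded (range (\<lambda>k. F (x k)))"
    using bounded_subset compact_imp_bounded by blast
  from cone_decseq_convergent[OF C F_decreasing this]
  obtain m where "(\<lambda>k. F (x k)) \<longlonglongrightarrow> m" "\<And>k. F (x k) - m \<in> C"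
    by blast
  moreover from this have "F_lim = m"
    by (simp add: F_lim_def limI)
  ultimately show "(\<lambda>k. F (x k)) \<longlonglongrightarrow> F_lim" "F (x k) - F_lim \<in> C"
    by auto
qed

text \<open>For one fixed \<open>c\<close> in the dual base, \<open>sufficient_decrease\<close>
  telescopes against \<open>c \<bullet> (F (x 0) - F_lim)\<close>.\<close>

lemma summable_d: "summable d"
proof -
  obtain c where c: "c \<in> dual_base C"
    using dual_base_nonempty[OF C] by blast
  let ?\<kappa> = "l * (1 + \<alpha>) - L"
  have "(\<Sum>k<n. d k) \<le> (c \<bullet> (F (x 0) - F_lim)) / ?\<kappa>" for n
  proof -
    have "?\<kappa> * (\<Sum>k<n. d k) \<le> c \<bullet> (F (x 0) - F (x n))"
    proof (induction n)
      case (Suc n)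
      then show ?case
        using sufficient_decrease[OF c, of n] by (simp add: distrib_left inner_diff_right)
    qed simp
    also have "\<dots> \<le> c \<bullet> (F (x 0) - F_lim)"
      using dual_base_inner_nonneg[OF c F_lim(2), of n] by (simp add: inner_diff_right)
    finally show ?thesis
      using decrease_coeff_pos by (simp add: pos_le_divide_eq mult.commute)
  qed
  then show ?thesis
    by (intro summableI_nonneg_bounded d_nonneg)
qed

section \<open>Accumulation points, weak efficiency and the ergodic rate\<close>

lemma accumulation_point:
  assumes "(x \<circ> s) \<longlonglongrightarrow> a" "strict_mono s"
  shows "a \<in> W" "F a = F_lim"
proof -
  show "a \<in> W"
    using closed_W assms(1) x_in_W closed_sequentially[of W "x \<circ> s"] by auto
  have "isCont F a"
    using F by (simp add: continuous_on_eq_continuous_at)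
  then have "(\<lambda>k. F ((x \<circ> s) k)) \<longlonglongrightarrow> F a"
    using assms(1) by (rule isCont_tendsto_compose)
  moreover have "(\<lambda>k. F ((x \<circ> s) k)) \<longlonglongrightarrow> F_lim"
    using LIMSEQ_subseq_LIMSEQ[OF F_lim(1) assms(2)] by (simp add: o_def)
  ultimately show "F a = F_lim"
    by (rule LIMSEQ_unique)
qed

text \<open>Since \<open>F_lim\<close> lies below every value of the run, a margin
  \<open>\<delta>\<close> measured at \<open>F_lim\<close> holds at each iterate.\<close>

lemma run_estimate:
  assumes y: "y \<in> W" and \<delta>: "\<And>c. c \<in> dual_base C \<Longrightarrow> \<delta> \<le> c \<bullet> (F_lim - F y)"
  shows "\<delta> + l * D y (x (Suc k)) \<le> l * D y (x k) + (L - l) * d k"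
proof (rule step_estimate[OF dual_base_nonempty[OF C] order_refl x_interior x_Suc y])
  fix c assume c: "c \<in> dual_base C"
  show "\<delta> \<le> c \<bullet> (F (x (Suc k)) - F y)"
    using \<delta>[OF c] dual_base_inner_nonneg[OF c F_lim(2), of "Suc k"]
    by (simp add: inner_diff_right)
qed

text \<open>A strictly better \<open>y\<close> would have a positive margin \<open>\<delta>\<close>
  uniform over the dual base. Each step would then lower \<open>l * D y (x n)\<close> by
  \<open>\<delta>\<close> up to a summable error, but this quantity stays nonnegative.\<close>

lemma weakly_efficient_limit_value:
  assumes "a \<in> W" "F a = F_lim"
  shows "weakly_efficient C W F a"
  unfolding weakly_efficient_def
proof (intro conjI notI)
  assume "\<exists>y\<in>W. F y \<prec>\<^bsub>C\<^esub> F a"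
  then obtain y where y: "y \<in> W" "F_lim - F y \<in> interior C"
    by (auto simp: cone_less_def assms)
  obtain \<delta> where \<delta>: "\<delta> > 0" "\<And>c. c \<in> dual_base C \<Longrightarrow> \<delta> \<le> c \<bullet> (F_lim - F y)"
    using dual_base_interior_bound[OF y(2)] by blast
  \<comment> \<open>The absolute value is taken because \<open>l\<close> may lie on either side of
    \<open>L\<close>.\<close>
  have sum: "real n * \<delta> + l * D y (x n) \<le> l * D y (x 0) + \<bar>L - l\<bar> * (\<Sum>k<n. d k)" for n
  proof (induction n)
    case (Suc n)
    have "(L - l) * d n \<le> \<bar>L - l\<bar> * d n"
      using d_nonneg by (intro mult_right_mono) auto
    then show ?case
      using Suc run_estimate[OF y(1) \<delta>(2), of n] by (simp add: algebra_simps)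
  qed simp
  have nonneg: "0 \<le> l * D y (x n)" for n
    using bregman_real_nonneg[OF x_interior y(1)] l_pos by simp
  have tail: "\<bar>L - l\<bar> * (\<Sum>k<n. d k) \<le> \<bar>L - l\<bar> * suminf d" for n
    using sum_le_suminf[OF summable_d] d_nonneg by (intro mult_left_mono) auto
  have bound: "real n * \<delta> \<le> l * D y (x 0) + \<bar>L - l\<bar> * suminf d" for n
    using sum[of n] nonneg[of n] tail[of n] by linarith
  obtain n where "l * D y (x 0) + \<bar>L - l\<bar> * suminf d < real n * \<delta>"
    using reals_Archimedean3[OF \<delta>(1)] by blast
  then show False
    using bound[of n] by simp
qed (rule assms)

text \<open>At \<open>y = a\<close> the margin is 0, so the distances from \<open>a\<close> are
  quasi-Fejer with errors \<open>\<bar>L - l\<bar> / l * d k\<close>.\<close>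

lemma bregman_to_accumulation_point:
  assumes a: "a \<in> W" "F a = F_lim" and s: "strict_mono s" "(\<lambda>k. D a (x (s k))) \<longlonglongrightarrow> 0"
  shows "(\<lambda>k. D a (x k)) \<longlonglongrightarrow> 0"
proof (rule quasi_Fejer_tendsto_0)
  fix k
  have "l * D a (x (Suc k)) \<le> l * D a (x k) + (L - l) * d k"
    using run_estimate[of a 0 k] a by simp
  also have "\<dots> \<le> l * D a (x k) + \<bar>L - l\<bar> * d k"
    using d_nonneg by (intro add_left_mono mult_right_mono) auto
  finally show "D a (x (Suc k)) \<le> D a (x k) + \<bar>L - l\<bar> / l * d k"
    using l_pos by (simp add: field_simps)
  show "0 \<le> \<bar>L - l\<bar> / l * d k"
    using l_pos d_nonneg by simp
  show "0 \<le> D a (x k)"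
    using bregman_real_nonneg[OF x_interior a(1)] .
qed (use s summable_d in \<open>auto intro: summable_mult\<close>)

text \<open>With a singleton \<open>H\<close> the margin in \<open>step_estimate\<close> can be the
  exact value \<open>c p \<bullet> (F (x (Suc p)) - F_lim)\<close>. The estimates telescope, and the
  final distance is dropped as nonnegative.\<close>

lemma ergodic_rate:
  assumes c: "\<And>p. c p \<in> dual_base C" "\<And>p. prox_point (model {c p} (x p)) l (x p) (x (Suc p))"
    and a: "a \<in> W" "F a = F_lim" and k: "k \<ge> 1"
  shows "((1 / real k) *\<^sub>R (\<Sum>p<k. c p)) \<bullet> (F (x k) - F_lim)
    \<le> (l * D a (x 0) + (L - l) * (\<Sum>p<k. d p)) / real k"
proof -
  have "(\<Sum>p<n. c p \<bullet> (F (x (Suc p)) - F_lim)) + l * D a (x n)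
      \<le> l * D a (x 0) + (L - l) * (\<Sum>p<n. d p)" for n
  proof (induction n)
    case (Suc n)
    have "c n \<bullet> (F (x (Suc n)) - F_lim) + l * D a (x (Suc n)) \<le> l * D a (x n) + (L - l) * d n"
      using step_estimate[OF _ _ x_interior c(2) a(1)] c(1) a(2) by simp
    then show ?case
      using Suc by (simp add: algebra_simps)
  qed simp
  moreover have "0 \<le> l * D a (x k)"
    using bregman_real_nonneg[OF x_interior a(1)] l_pos by simp
  \<comment> \<open>All indices \<open>Suc p\<close> are at most \<open>k\<close>, so monotonicity
    replaces the intermediate values by the last one.\<close>
  moreover have "(\<Sum>p<k. c p \<bullet> (F (x k) - F_lim)) \<le> (\<Sum>p<k. c p \<bullet> (F (x (Suc p)) - F_lim))"
  proof (rule sum_mono)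
    fix p assume "p \<in> {..<k}"
    then have "F (x (Suc p)) - F (x k) \<in> C"
      by (intro F_antimono) auto
    from dual_base_inner_nonneg[OF c(1) this]
    show "c p \<bullet> (F (x k) - F_lim) \<le> c p \<bullet> (F (x (Suc p)) - F_lim)"
      by (simp add: inner_diff_right)
  qed
  ultimately have "(\<Sum>p<k. c p) \<bullet> (F (x k) - F_lim) \<le> l * D a (x 0) + (L - l) * (\<Sum>p<k. d p)"
    unfolding inner_sum_left by (smt (verit))
  then show ?thesis
    using k by (simp add: divide_right_mono)
qed

end

section \<open>Extended-valued Legendre functions\<close>

text \<open>\<open>grad\<close> is a definite description: the adjoint of the derivative, evaluated
  at 1, gives existence, and derivatives are unique.\<close>

lemma grad_GDERIV:
  fixes \<omega> :: "'a::euclidean_space \<Rightarrow> ereal"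
  assumes "(\<lambda>z. real_of_ereal (\<omega> z)) differentiable (at p)"
  shows "GDERIV (\<lambda>z. real_of_ereal (\<omega> z)) p :> grad \<omega> p"
proof -
  obtain f' where f': "((\<lambda>z. real_of_ereal (\<omega> z)) has_derivative f') (at p)"
    using assms by (auto simp: differentiable_def)
  then have "linear f'"
    by (rule has_derivative_linear)
  then have "f' = (\<lambda>h. h \<bullet> adjoint f' 1)"
    by (simp add: adjoint_works)
  then have ex: "GDERIV (\<lambda>z. real_of_ereal (\<omega> z)) p :> adjoint f' 1"
    using f' by (simp add: gderiv_def)
  have unique: "D = D'" if "GDERIV (\<lambda>z. real_of_ereal (\<omega> z)) p :> D"
    "GDERIV (\<lambda>z. real_of_ereal (\<omega> z)) p :> D'" for D D'
  proof -
    have "(\<lambda>h. h \<bullet> D) = (\<lambda>h. h \<bullet> D')"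
      using that unfolding gderiv_def by (rule has_derivative_unique)
    from fun_cong[OF this] have "\<forall>h. h \<bullet> D = h \<bullet> D'" ..
    then show ?thesis
      by (rule vector_eq_ldot[THEN iffD1])
  qed
  have "\<exists>!D. GDERIV (\<lambda>z. real_of_ereal (\<omega> z)) p :> D"
    using ex unique by blast
  then show ?thesis
    unfolding grad_def by (rule theI')
qed

locale legendre_dom =
  fixes \<omega> :: "'a::euclidean_space \<Rightarrow> ereal" and \<Omega> :: "'a set"
  assumes legendre: "legendre \<omega>" and dom: "edom \<omega> = \<Omega>" and closed: "closed \<Omega>"
    and interior: "interior \<Omega> \<noteq> {}" and supercoercive: "supercoercive \<omega>"
begin

abbreviation w where "w \<equiv> \<lambda>z. real_of_ereal (\<omega> z)"

lemma finite_on_dom: "y \<in> \<Omega> \<Longrightarrow> \<omega> y = ereal (w y)"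
  using legendre dom unfolding legendre_def proper_closed_convex_def edom_def
  by (cases "\<omega> y") auto

text \<open>Carries closedness and convexity over to \<open>w\<close>. Outside
  \<open>\<Omega>\<close> the function \<open>w\<close> has the default value 0, hence the explicit
  \<open>y \<in> \<Omega>\<close>.\<close>

lemma epigraph_eq: "{(y, s::real). \<omega> y \<le> ereal s} = {(y, s). y \<in> \<Omega> \<and> w y \<le> s}"
proof -
  have "\<omega> y \<le> ereal s \<longleftrightarrow> y \<in> \<Omega> \<and> w y \<le> s" for y s
  proof (cases "y \<in> \<Omega>")
    case True
    then show ?thesis
      using finite_on_dom[OF True] by (metis ereal_less_eq(3))
  next
    case False
    then show ?thesis
      using dom by (auto simp: edom_def)
  qed
  then show ?thesis
    by simp
qed

sublocale legendre_real \<Omega> w "grad \<omega>"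
proof
  show "convex_on \<Omega> w"
    using legendre epigraph_eq
    unfolding legendre_def proper_closed_convex_def convex_epigraph_convex epigraph_def
    by (simp add: case_prod_unfold)
  show "closed {(y, s). y \<in> \<Omega> \<and> w y \<le> s}"
    using legendre unfolding legendre_def proper_closed_convex_def epigraph_eq by blast
  show "GDERIV w z :> grad \<omega> z" if "z \<in> interior \<Omega>" for z
    using that legendre dom
    by (intro grad_GDERIV) (auto simp: legendre_def essentially_smooth_def)
  show "filterlim (\<lambda>k. norm (grad \<omega> (u k))) at_top sequentially"
    if "\<And>k. u k \<in> interior \<Omega>" "b \<in> frontier \<Omega>" "u \<longlonglongrightarrow> b" for u b
    using that legendre unfolding legendre_def essentially_smooth_def dom by blast
  show "w (t *\<^sub>R y + (1 - t) *\<^sub>R z) < t * w y + (1 - t) * w z"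
    if "y \<in> interior \<Omega>" "z \<in> interior \<Omega>" "y \<noteq> z" "0 < t" "t < 1" for y z t
  proof -
    have in_dom: "y \<in> \<Omega>" "z \<in> \<Omega>"
      using that interior_subset by blast+
    have comb: "t *\<^sub>R y + (1 - t) *\<^sub>R z \<in> \<Omega>"
      using that in_dom by (intro convexD[OF convex_on_imp_convex[OF \<open>convex_on \<Omega> w\<close>]]) auto
    have "\<omega> (t *\<^sub>R y + (1 - t) *\<^sub>R z) < ereal t * \<omega> y + ereal (1 - t) * \<omega> z"
      using that legendre unfolding legendre_def strictly_convex_interior_def dom by auto
    moreover obtain a b c where "\<omega> y = ereal a" "\<omega> z = ereal b"
        "\<omega> (t *\<^sub>R y + (1 - t) *\<^sub>R z) = ereal c"
      using in_dom[THEN finite_on_dom] finite_on_dom[OF comb] by blast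
    ultimately show ?thesis
      by simp
  qed
  show "\<exists>B. \<forall>y\<in>\<Omega>. B \<le> norm y \<longrightarrow> M * norm y \<le> w y" for M
  proof -
    obtain B where B: "\<And>y. B \<le> norm y \<Longrightarrow> ereal M < \<omega> y / ereal (norm y)"
      using supercoercive unfolding supercoercive_def tendsto_PInfty eventually_at_infinity by blast
    \<comment> \<open>The bound 1 keeps the norm positive, so the quotient can be cleared.\<close>
    have "M * norm y \<le> w y" if y: "y \<in> \<Omega>" "max B 1 \<le> norm y" for y
    proof -
      have "ereal M < ereal (w y) / ereal (norm y)"
        using B[of y] y(2) finite_on_dom[OF y(1)] by (metis max.bounded_iff)
      moreover have "norm y > 0"
        using y by linarith
      ultimately show ?thesis
        by (simp add: pos_less_divide_eq)
    qed
    then show ?thesis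
      by blast
  qed
qed (use closed interior in auto)

lemma bregman_eq: "z \<in> interior \<Omega> \<Longrightarrow> y \<in> \<Omega> \<Longrightarrow> bregman \<omega> y z = ereal (D y z)"
  using finite_on_dom[of y] finite_on_dom[of z] interior_subset_W[of z]
  unfolding bregman_def bregman_real_def by (metis ereal_minus(1))

lemma symmetry_coeff:
  shows symmetry_coeff_nonneg: "0 \<le> symmetry_coeff \<omega>"
    and symmetry_coeff_le: "\<lbrakk>p \<in> interior \<Omega>; y \<in> interior \<Omega>\<rbrakk> \<Longrightarrow> symmetry_coeff \<omega> * D y p \<le> D p y"
proof -
  define S where "S = {D y z / D z y | y z. y \<in> interior \<Omega> \<and> z \<in> interior \<Omega> \<and> y \<noteq> z}"
  have "{real_of_ereal (bregman \<omega> y z) / real_of_ereal (bregman \<omega> z y) | y z.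
      y \<in> interior \<Omega> \<and> z \<in> interior \<Omega> \<and> y \<noteq> z} = S"
    unfolding S_def using bregman_eq interior_subset_W
    by (intro Collect_cong ex_cong1) (metis real_of_ereal.simps(1))
  then have coeff: "symmetry_coeff \<omega> = Inf S"
    by (simp add: symmetry_coeff_def dom)
  obtain q where q: "q \<in> interior \<Omega>"
    using interior by blast
  \<comment> \<open>A nonempty open set is never a single point here, so \<open>S\<close> is
    nonempty and its infimum is not a default value.\<close>
  then have "interior \<Omega> \<noteq> {q}"
    using not_open_singleton[of q] open_interior by metis
  then have "S \<noteq> {}"
    using q by (auto simp: S_def)
  moreover have nonneg: "0 \<le> s" if "s \<in> S" for s
    using that bregman_real_nonneg interior_subset_W by (force simp: S_def)
  ultimately show "0 \<le> symmetry_coeff \<omega>"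
    unfolding coeff by (rule cInf_greatest)
  show "symmetry_coeff \<omega> * D y p \<le> D p y" if py: "p \<in> interior \<Omega>" "y \<in> interior \<Omega>"
  proof (cases "p = y")
    case True
    then show ?thesis
      by (simp add: bregman_real_def)
  next
    case False
    then have "symmetry_coeff \<omega> \<le> D p y / D y p"
      unfolding coeff using py nonneg by (intro cInf_lower bdd_belowI) (auto simp: S_def)
    moreover have "0 < D y p"
      using bregman_real_pos py False by auto
    ultimately show ?thesis
      by (simp add: pos_le_divide_eq)
  qed
qed

text \<open>For fixed \<open>y\<close> in \<open>\<Omega>\<close> the Bregman term is finite and
  independent of \<open>c\<close>, so the infimum becomes minus a supremum. Maximising the step
  objective is thus the proximal problem.\<close>

lemma INF_step_objective:
  assumes H: "H \<noteq> {}" "H \<subseteq> cball 0 1" and A: "linear A"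
    and p: "p \<in> interior \<Omega>" and y: "y \<in> \<Omega>"
  shows "(INF c\<in>H. ereal (c \<bullet> A (p - y)) - ereal l * bregman \<omega> y p)
    = ereal (- (support H (A (y - p)) + l * D y p))"
proof -
  have neg: "c \<bullet> A (p - y) = - (c \<bullet> A (y - p))" for c
    using A by (simp add: linear_diff inner_diff_right)
  show ?thesis
    unfolding bregman_eq[OF p y]
  proof (rule INF_eqI)
    fix c assume "c \<in> H"
    then show "ereal (- (support H (A (y - p)) + l * D y p)) \<le> ereal (c \<bullet> A (p - y)) - ereal l * ereal (D y p)"
      using support_upper[OF H(2), of c "A (y - p)"] by (simp add: neg)
  next
    fix b assume b: "\<And>c. c \<in> H \<Longrightarrow> b \<le> ereal (c \<bullet> A (p - y)) - ereal l * ereal (D y p)"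
    obtain c where "c \<in> H"
      using H by blast
    show "b \<le> ereal (- (support H (A (y - p)) + l * D y p))"
    proof (cases b)
      case (real s)
      have "support H (A (y - p)) \<le> - s - l * D y p"
        using H(1) b unfolding real by (intro support_least) (force simp: neg)+
      then show ?thesis
        by (simp add: real)
    next
      case PInf
      then show ?thesis
        using b[OF \<open>c \<in> H\<close>] by simp
    qed simp
  qed
qed

lemma is_arg_max_step_iff:
  assumes H: "H \<noteq> {}" "H \<subseteq> cball 0 1" and A: "linear A" and p: "p \<in> interior \<Omega>"
  shows "is_arg_max (\<lambda>y. INF c\<in>H. ereal (c \<bullet> A (p - y)) - ereal l * bregman \<omega> y p) (\<lambda>y. y \<in> \<Omega>) v
    \<longleftrightarrow> prox_point (\<lambda>y. support H (A (y - p))) l p v"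
  by (auto simp: is_arg_max_def prox_point_def INF_step_objective[OF assms] not_less simp del: ereal_minus)

end

section \<open>The convergence theorem\<close>

text \<open>After scalarising by \<open>c\<close>, convexity bounds the difference quotients from
  \<open>p\<close> towards \<open>y\<close> by \<open>c \<bullet> (F y - F p)\<close>, and the bound
  passes to the limit.\<close>

lemma C_convex_on_derivative_le:
  fixes F :: "'a::real_normed_vector \<Rightarrow> 'b::euclidean_space"
  assumes C: "ordering_cone C" and conv: "C_convex_on C \<Omega> F"
    and F': "(F has_derivative F') (at p)" and p: "p \<in> \<Omega>" and y: "y \<in> \<Omega>"
  shows "F y - F p - F' (y - p) \<in> C"
  unfolding ordering_cone_mem_iff[OF C]
proof
  fix c assume c: "c \<in> dual_base C"
  let ?\<phi> = "\<lambda>t. c \<bullet> F (p + t *\<^sub>R (y - p))"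
  have "((\<lambda>t. p + t *\<^sub>R (y - p)) has_derivative (\<lambda>t. t *\<^sub>R (y - p))) (at 0)"
    by (auto intro!: derivative_eq_intros)
  moreover have "(F has_derivative F') (at (p + 0 *\<^sub>R (y - p)))"
    using F' by simp
  ultimately have "((\<lambda>t. F (p + t *\<^sub>R (y - p))) has_derivative (\<lambda>t. F' (t *\<^sub>R (y - p)))) (at (0::real))"
    by (rule has_derivative_compose)
  then have "(?\<phi> has_derivative (\<lambda>t. c \<bullet> F' (t *\<^sub>R (y - p)))) (at 0)"
    by (rule has_derivative_inner_right)
  moreover have "(\<lambda>t. c \<bullet> F' (t *\<^sub>R (y - p))) = (*) (c \<bullet> F' (y - p))"
    using has_derivative_linear[OF F'] by (auto simp: linear_scale mult.commute)
  ultimately have "(?\<phi> has_real_derivative (c \<bullet> F' (y - p))) (at 0)"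
    by (simp add: has_field_derivative_def)
  then have "((\<lambda>t. (?\<phi> t - c \<bullet> F p) / t) \<longlongrightarrow> c \<bullet> F' (y - p)) (at 0)"
    by (simp add: DERIV_def)
  then have "((\<lambda>t. (?\<phi> t - c \<bullet> F p) / t) \<longlongrightarrow> c \<bullet> F' (y - p)) (at_right 0)"
    by (rule tendsto_within_subset) auto
  moreover have "eventually (\<lambda>t. (?\<phi> t - c \<bullet> F p) / t \<le> c \<bullet> (F y - F p)) (at_right (0::real))"
    unfolding eventually_at_right_field
  proof (intro exI[of _ 1] conjI allI impI)
    fix t :: real assume t: "0 < t" "t < 1"
    have eq: "p + t *\<^sub>R (y - p) = t *\<^sub>R y + (1 - t) *\<^sub>R p"
      by (simp add: algebra_simps)
    have "t *\<^sub>R F y + (1 - t) *\<^sub>R F p - F (p + t *\<^sub>R (y - p)) \<in> C"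
      using conv p y t unfolding C_convex_on_def cone_le_def eq by auto
    from dual_base_inner_nonneg[OF c this]
    have "?\<phi> t - c \<bullet> F p \<le> (c \<bullet> (F y - F p)) * t"
      by (simp add: inner_diff_right inner_add_right algebra_simps)
    then show "(?\<phi> t - c \<bullet> F p) / t \<le> c \<bullet> (F y - F p)"
      using t by (simp add: pos_divide_le_eq)
  qed simp
  ultimately have "c \<bullet> F' (y - p) \<le> c \<bullet> (F y - F p)"
    by (rule tendsto_upperbound) simp
  then show "0 \<le> c \<bullet> (F y - F p - F' (y - p))"
    by (simp add: inner_diff_right)
qed

theorem theorem3:
  fixes C :: "(real^'m) set" and \<Omega> :: "(real^'n) set"
    and F :: "real^'n \<Rightarrow> real^'m" and \<omega> :: "real^'n \<Rightarrow> ereal"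
    and e :: "real^'m" and r L l :: real and x :: "nat \<Rightarrow> real^'n"
  assumes "ordering_cone C"
    and "closed \<Omega>" and "convex \<Omega>" and "interior \<Omega> \<noteq> {}"
    and "\<And>z. F differentiable (at z)"
    and "legendre \<omega>" and "closure (edom \<omega>) = \<Omega>" and "supercoercive \<omega>"
    and "scaling_vector C r e"
    and "bounded {z. F z \<preceq>\<^bsub>C\<^esub> F (x 0)}"
    and "relatively_smooth C e \<Omega> \<omega> L F"
    and "l > L / (1 + symmetry_coeff \<omega>)"
    and "C_convex_on C \<Omega> F"
    and "interior_bregman_run C \<Omega> \<omega> F l x"
    and "\<And>k. \<not> C_stationary C \<Omega> F (x k)"
  shows "\<exists>Fs.
     ((\<forall>k. Fs \<preceq>\<^bsub>C\<^esub> F (x k)) \<and> (\<lambda>k. F (x k)) \<longlonglongrightarrow> Fs) \<and>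
     (\<Sum>k. bregman \<omega> (x (Suc k)) (x k)) < \<infinity> \<and>
     (\<forall>a. (\<exists>s. strict_mono s \<and> (x \<circ> s) \<longlonglongrightarrow> a) \<longrightarrow> weakly_efficient C \<Omega> F a) \<and>
     (bregman_convergence \<omega> \<Omega> \<longrightarrow>
       (\<exists>xs. weakly_efficient C \<Omega> F xs \<and> x \<longlonglongrightarrow> xs \<and>
          (\<forall>c :: real^'n \<Rightarrow> real^'m.
             (\<forall>p. step_multiplier C \<Omega> \<omega> F l (x p) (c (x p))) \<longrightarrow>
             (\<forall>k\<ge>1.
                ereal (((1 / real k) *\<^sub>R (\<Sum>p<k. c (x p))) \<bullet> (F (x k) - Fs))
                  \<le> (ereal l * bregman \<omega> xs (x 0)
                      + ereal (L - l) * (\<Sum>p<k. bregman \<omega> (x (Suc p)) (x p))) / ereal (real k) \<and>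
                (l \<ge> L \<longrightarrow>
                  ereal (((1 / real k) *\<^sub>R (\<Sum>p<k. c (x p))) \<bullet> (F (x k) - Fs))
                    \<le> ereal l * bregman \<omega> xs (x 0) / ereal (real k))))))"
proof -
  have "\<Omega> \<subseteq> edom \<omega>" "L > 0"
    using assms(11) by (simp_all add: relatively_smooth_def)
  \<comment> \<open>Relative smoothness places \<open>\<Omega>\<close> inside the domain, whose
    closure it is.\<close>
  then have dom: "edom \<omega> = \<Omega>"
    using assms(7) closure_subset by blast
  interpret legendre_dom \<omega> \<Omega>
    using assms dom by unfold_locales auto
  let ?J = "\<lambda>p. (*v) (jac F p)"
  have F': "(F has_derivative ?J p) (at p)" for p
    using assms(5) jacobian_works by blast
  have G: "dual_base C \<noteq> {}" "dual_base C \<subseteq> cball 0 1"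
    using dual_base_nonempty[OF assms(1)] norm_dual_base_le by fastforce+
  have "L / (1 + symmetry_coeff \<omega>) > 0"
    using \<open>L > 0\<close> symmetry_coeff_nonneg by (simp add: add_pos_nonneg)
  then have "l > 0"
    using assms(12) by linarith
  \<comment> \<open>Existence and uniqueness of the proximal point give the definite description
    \<open>bregman_step\<close> its meaning.\<close>
  have step: "prox_point (\<lambda>y. support (dual_base C) (?J p (y - p))) l p (bregman_step C \<Omega> \<omega> F l p)"
    if p: "p \<in> interior \<Omega>" for p
  proof -
    note lip = lipschitz_on_support_linear[OF G matrix_vector_mul_bounded_linear]
      and conv = convex_on_support_linear[OF G matrix_vector_mul_linear convex_W]
    obtain v where v: "prox_point (\<lambda>y. support (dual_base C) (?J p (y - p))) l p v"
      using prox_point_exists[OF \<open>l > 0\<close> lip p] by blast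
    then have "bregman_step C \<Omega> \<omega> F l p = v"
      unfolding bregman_step_def is_arg_max_step_iff[OF G matrix_vector_mul_linear p]
      using prox_point_unique[OF \<open>l > 0\<close> lip conv] by (intro the_equality)
    then show ?thesis
      using v by simp
  qed
  have run: "x 0 \<in> interior \<Omega>" "\<And>k. x (Suc k) = bregman_step C \<Omega> \<omega> F l (x k)"
    using assms(14) by (auto simp: interior_bregman_run_def)
  \<comment> \<open>This precedes the interpretation, since \<open>step\<close> applies only at
    interior points.\<close>
  have x_interior: "x k \<in> interior \<Omega>" for k
  proof (induction k)
    case (Suc k)
    show ?case
      using prox_point_interior[OF \<open>l > 0\<close> lipschitz_on_support_linear[OF G matrix_vector_mul_bounded_linear] step[OF Suc]]
      by (simp add: run)
  qed (rule run)
  interpret interior_bregman \<Omega> w "grad \<omega>" C e F ?J L l "symmetry_coeff \<omega>" x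
  proof (rule interior_bregman.intro[OF legendre_real_axioms], rule interior_bregman_axioms.intro)
    show "F y - F p - jac F p *v (y - p) \<in> C" if "p \<in> interior \<Omega>" "y \<in> \<Omega>" for p y
      using C_convex_on_derivative_le[OF assms(1) assms(13) F'] that interior_subset by blast
    show "F p + jac F p *v (y - p) + (L * D y p) *\<^sub>R e - F y \<in> C"
      if "p \<in> interior \<Omega>" "y \<in> interior \<Omega>" for p y
    proof -
      have "F p + jac F p *v (y - p) + (L * real_of_ereal (bregman \<omega> y p)) *\<^sub>R e - F y \<in> C"
        using assms(11) that by (simp add: relatively_smooth_def cone_le_def)
      then show ?thesis
        using bregman_eq that interior_subset_W by simp
    qed
    show "continuous_on UNIV F"
      using F' has_derivative_continuous_on[of UNIV F ?J] by auto
    show "prox_point (\<lambda>y. support (dual_base C) (jac F (x k) *v (y - x k))) l (x k) (x (Suc k))" for k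
      using step[OF x_interior] by (simp add: run)
    show "bounded {z. F (x 0) - F z \<in> C}"
      using assms(10) by (simp add: cone_le_def)
    show "c \<bullet> e \<le> 1" if "c \<in> dual_base C" for c
      using scaling_vector_inner_le_1[OF assms(9) that] .
    show "linear (?J p)" for p
      by (rule matrix_vector_mul_linear)
  qed (fact assms(1) \<open>L > 0\<close> assms(12) run(1) symmetry_coeff_nonneg symmetry_coeff_le)+
  have d_eq: "bregman \<omega> (x (Suc k)) (x k) = ereal (d k)" for k
    using bregman_eq x_interior x_in_W by blast
  have rate: "ereal (((1 / real k) *\<^sub>R (\<Sum>p<k. c (x p))) \<bullet> (F (x k) - F_lim))
      \<le> (ereal l * bregman \<omega> a (x 0) + ereal (L - l) * (\<Sum>p<k. bregman \<omega> (x (Suc p)) (x p)))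
        / ereal (real k) \<and>
      (l \<ge> L \<longrightarrow> ereal (((1 / real k) *\<^sub>R (\<Sum>p<k. c (x p))) \<bullet> (F (x k) - F_lim))
        \<le> ereal l * bregman \<omega> a (x 0) / ereal (real k))"
    if c: "\<forall>p. step_multiplier C \<Omega> \<omega> F l (x p) (c (x p))" and k: "k \<ge> 1"
      and a: "a \<in> \<Omega>" "F a = F_lim" for c a k
  proof -
    have cG: "c (x p) \<in> dual_base C" for p
      using c by (auto simp: step_multiplier_def)
    have "prox_point (\<lambda>y. support {c (x p)} (?J (x p) (y - x p))) l (x p) (x (Suc p))" for p
    proof -
      \<comment> \<open>The multiplier condition is read as the singleton case of the step
        objective.\<close>
      have "is_arg_max (\<lambda>y. INF c\<in>{c (x p)}. ereal (c \<bullet> (jac F (x p) *v (x p - y))) - ereal l * bregman \<omega> y (x p))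
          (\<lambda>y. y \<in> \<Omega>) (x (Suc p))"
        using c by (simp add: step_multiplier_def run)
      then show ?thesis
        using cG norm_dual_base_le
        by (subst (asm) is_arg_max_step_iff[OF _ _ matrix_vector_mul_linear x_interior]) auto
    qed
    from ergodic_rate[where c = "\<lambda>p. c (x p)", OF cG this a k]
    have le: "((1 / real k) *\<^sub>R (\<Sum>p<k. c (x p))) \<bullet> (F (x k) - F_lim)
        \<le> (l * D a (x 0) + (L - l) * (\<Sum>p<k. d p)) / real k" .
    moreover have "(l * D a (x 0) + (L - l) * (\<Sum>p<k. d p)) / real k \<le> l * D a (x 0) / real k" if "l \<ge> L"
      using that d_nonneg k
      by (intro divide_right_mono) (auto simp: mult_nonpos_nonneg sum_nonneg)
    ultimately show ?thesis
      using k unfolding d_eq bregman_eq[OF x_interior a(1)] by auto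
  qed
  have xs: "\<exists>xs. weakly_efficient C \<Omega> F xs \<and> x \<longlonglongrightarrow> xs \<and> xs \<in> \<Omega> \<and> F xs = F_lim"
    if conv: "bregman_convergence \<omega> \<Omega>"
  proof -
    obtain a s where s: "strict_mono s" "(x \<circ> s) \<longlonglongrightarrow> a"
      using bounded_imp_convergent_subsequence[OF bounded_x] by blast
    note a = accumulation_point[OF s(2,1)]
    \<comment> \<open>The first half of the assumption turns convergence of the subsequence into
      vanishing distances, quasi-Fejer monotonicity extends this to the whole run, and the second
      half returns to convergence of points.\<close>
    have "(\<lambda>k. bregman \<omega> a ((x \<circ> s) k)) \<longlonglongrightarrow> 0"
      using conv a(1) s(2) x_interior unfolding bregman_convergence_def by (metis comp_apply)
    then have "(\<lambda>k. D a (x (s k))) \<longlonglongrightarrow> 0"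
      by (simp add: bregman_eq[OF x_interior a(1)] zero_ereal_def)
    then have "(\<lambda>k. D a (x k)) \<longlonglongrightarrow> 0"
      using bregman_to_accumulation_point a s(1) by blast
    then have "(\<lambda>k. bregman \<omega> a (x k)) \<longlonglongrightarrow> 0"
      by (simp add: bregman_eq[OF x_interior a(1)] zero_ereal_def)
    then have "x \<longlonglongrightarrow> a"
      using conv a(1) x_interior unfolding bregman_convergence_def by blast
    then show ?thesis
      using a weakly_efficient_limit_value by blast
  qed
  show ?thesis
  proof (intro exI[of _ F_lim] conjI allI impI)
    show "F_lim \<preceq>\<^bsub>C\<^esub> F (x k)" for k
      using F_lim(2) by (simp add: cone_le_def)
    show "(\<lambda>k. F (x k)) \<longlonglongrightarrow> F_lim"
      by (rule F_lim)
    show "(\<Sum>k. bregman \<omega> (x (Suc k)) (x k)) < \<infinity>"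
      using suminf_ereal_finite[OF summable_d] by (simp add: d_eq)
    show "weakly_efficient C \<Omega> F a" if "\<exists>s. strict_mono s \<and> (x \<circ> s) \<longlonglongrightarrow> a" for a
      using that accumulation_point weakly_efficient_limit_value by blast
    assume "bregman_convergence \<omega> \<Omega>"
    from xs[OF this] obtain xs where xs: "weakly_efficient C \<Omega> F xs" "x \<longlonglongrightarrow> xs" "xs \<in> \<Omega>" "F xs = F_lim"
      by blast
    show "\<exists>xs. weakly_efficient C \<Omega> F xs \<and> x \<longlonglongrightarrow> xs \<and>
          (\<forall>c :: real^'n \<Rightarrow> real^'m.
             (\<forall>p. step_multiplier C \<Omega> \<omega> F l (x p) (c (x p))) \<longrightarrow>
             (\<forall>k\<ge>1.
                ereal (((1 / real k) *\<^sub>R (\<Sum>p<k. c (x p))) \<bullet> (F (x k) - F_lim))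
                  \<le> (ereal l * bregman \<omega> xs (x 0)
                      + ereal (L - l) * (\<Sum>p<k. bregman \<omega> (x (Suc p)) (x p))) / ereal (real k) \<and>
                (l \<ge> L \<longrightarrow>
                  ereal (((1 / real k) *\<^sub>R (\<Sum>p<k. c (x p))) \<bullet> (F (x k) - F_lim))
                    \<le> ereal l * bregman \<omega> xs (x 0) / ereal (real k))))"
      using xs rate by blast
  qed
qed

end
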